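(* Let $k\ge 2$ and $t_1,\ldots,t_k$ be positive integers, and let $e$ be an edge of the complete multipartite graph $K_{t_1,\ldots,t_k}$ joining a vertex of the $t_i$-part to a vertex of the $t_j$-part ($i\neq j$). Then: (1) If $k\ge 4$: if $t_i=t_j=1$ then $\mathcal{E}(K_{t_1,\ldots,t_k}-e)<\mathcal{E}(K_{t_1,\ldots,t_k})$; otherwise $\mathcal{E}(K_{t_1,\ldots,t_k}-e)>\mathcal{E}(K_{t_1,\ldots,t_k})$. (2) If $k=3$: if $t_i+t_j\le 3$ then $\mathcal{E}(K_{t_1,\ldots,t_k}-e)<\mathcal{E}(K_{t_1,\ldots,t_k})$; otherwise $\mathcal{E}(K_{t_1,\ldots,t_k}-e)>\mathcal{E}(K_{t_1,\ldots,t_k})$. (3) If $k=2$: if $\min\{t_i,t_j\}=1$ then $\mathcal{E}(K_{t_1,\ldots,t_k}-e)<\mathcal{E}(K_{t_1,\ldots,t_k})$; otherwise $\mathcal{E}(K_{t_1,\ldots,t_k}-e)>\mathcal{E}(K_{t_1,\ldots,t_k})$.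
   Context: All graphs are simple. The energy $\mathcal{E}(G)$ of a graph $G$ is the sum of the absolute values of the eigenvalues of its adjacency matrix. $K_{t_1,\ldots,t_k}$ denotes the complete multipartite graph with $k$ parts of sizes $t_1,\ldots,t_k$ (two vertices are adjacent iff they lie in different parts); the part of size $t_i$ is called the $t_i$-part. $G-e$ denotes the graph obtained by deleting the edge $e$ (keeping all vertices). *)

theory Defs
  imports Complex_Main "Jordan_Normal_Form.Char_Poly"
begin

record 'a sgraph =
  verts :: "'a set"
  edges :: "'a set set"

definition simple_graph :: "'a sgraph \<Rightarrow> bool" where
  "simple_graph G \<longleftrightarrow> finite (verts G) \<and>
     (\<forall>e \<in> edges G. \<exists>u \<in> verts G. \<exists>v \<in> verts G. u \<noteq> v \<and> e = {u, v})"

definition delete_edge :: "'a sgraph \<Rightarrow> 'a set \<Rightarrow> 'a sgraph" where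
  "delete_edge G e = G\<lparr>edges := edges G - {e}\<rparr>"

text \<open>The rows and columns of the adjacency matrix follow a list enumerating the vertices.
  The entries are taken in the complex numbers, so that the characteristic polynomial splits and
  every eigenvalue is present; since the matrix is real symmetric, they are the usual real ones.\<close>

definition adj_mat :: "'a sgraph \<Rightarrow> 'a list \<Rightarrow> complex mat" where
  "adj_mat G vs = mat (length vs) (length vs)
     (\<lambda>(i, j). if {vs ! i, vs ! j} \<in> edges G then 1 else 0)"

text \<open>Eigenvalues are counted with (algebraic) multiplicity.\<close>

definition mat_energy :: "complex mat \<Rightarrow> real" where
  "mat_energy A = (\<Sum>x \<in> {x. eigenvalue A x}. real (order x (char_poly A)) * cmod x)"

text \<open>The choice of the enumeration does not matter, see \<open>graph_energy_eq\<close> below.\<close>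

definition graph_energy :: "'a sgraph \<Rightarrow> real" where
  "graph_energy G = mat_energy (adj_mat G (SOME vs. distinct vs \<and> set vs = verts G))"

text \<open>The graph $K_{t_1,\dots,t_k}$: the vertices are the pairs \<open>(l, a)\<close> with
  \<open>1 \<le> l \<le> k\<close> and \<open>1 \<le> a \<le> t l\<close>, and the first component names the part.\<close>

definition part :: "(nat \<Rightarrow> nat) \<Rightarrow> nat \<Rightarrow> (nat \<times> nat) set" where
  "part t l = {l} \<times> {1..t l}"

definition complete_multipartite :: "nat \<Rightarrow> (nat \<Rightarrow> nat) \<Rightarrow> (nat \<times> nat) sgraph" where
  "complete_multipartite k t =
    \<lparr>verts = (\<Union>l \<in> {1..k}. part t l),
     edges = {{u, v} | u v l m.
       l \<in> {1..k} \<and> m \<in> {1..k} \<and> l \<noteq> m \<and> u \<in> part t l \<and> v \<in> part t m}\<rparr>"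

lemma simple_graph_delete_edge: "simple_graph G \<Longrightarrow> simple_graph (delete_edge G e)"
  by (auto simp: simple_graph_def delete_edge_def)

lemma simple_graph_complete_multipartite: "simple_graph (complete_multipartite k t)"
proof -
  have "\<exists>u \<in> verts (complete_multipartite k t). \<exists>v \<in> verts (complete_multipartite k t).
          u \<noteq> v \<and> e = {u, v}"
    if "e \<in> edges (complete_multipartite k t)" for e
  proof -
    from that obtain u v l m where e: "e = {u, v}"
      and lm: "l \<in> {1..k}" "m \<in> {1..k}" "l \<noteq> m" "u \<in> part t l" "v \<in> part t m"
      by (auto simp: complete_multipartite_def)
    have "u \<noteq> v" using lm by (auto simp: part_def)
    moreover have "u \<in> verts (complete_multipartite k t)" "v \<in> verts (complete_multipartite k t)"
      using lm by (auto simp: complete_multipartite_def)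
    ultimately show ?thesis using e by blast
  qed
  moreover have "finite (verts (complete_multipartite k t))"
    by (auto simp: complete_multipartite_def part_def)
  ultimately show ?thesis by (simp add: simple_graph_def)
qed

lemma mat_energy_similar:
  assumes "similar_mat A B"
  shows "mat_energy A = mat_energy B"
proof -
  from similar_matD[OF assms] obtain n where
    A: "A \<in> carrier_mat n n" and B: "B \<in> carrier_mat n n" by auto
  show ?thesis
    unfolding mat_energy_def eigenvalue_root_char_poly[OF A] eigenvalue_root_char_poly[OF B]
      char_poly_similar[OF assms] ..
qed

lemma similar_adj_mat:
  fixes vs ws :: "'a list"
  assumes vs: "distinct vs" and ws: "distinct ws" and eq: "set vs = set ws"
  shows "similar_mat (adj_mat G vs) (adj_mat G ws)"
proof -
  define n where "n = length vs"
  have len: "length vs = n" "length ws = n"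
    using distinct_card[OF vs] distinct_card[OF ws] eq by (simp_all add: n_def)
  define P :: "'a list \<Rightarrow> 'a list \<Rightarrow> complex mat"
    where "P xs ys = mat n n (\<lambda>(i, j). if xs ! i = ys ! j then 1 else 0)" for xs ys
  define idx :: "'a list \<Rightarrow> 'a \<Rightarrow> nat" where "idx ys x = (THE l. l < n \<and> ys ! l = x)" for ys x
  have idx: "idx ys (xs ! i) < n" "ys ! idx ys (xs ! i) = xs ! i"
      "\<And>l. l < n \<Longrightarrow> ys ! l = xs ! i \<longleftrightarrow> l = idx ys (xs ! i)"
      "\<And>l. l < n \<Longrightarrow> xs ! i = ys ! l \<longleftrightarrow> l = idx ys (xs ! i)"
    if "distinct ys" "length xs = n" "length ys = n" "set xs = set ys" "i < n" for xs ys i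
  proof -
    have ex: "\<exists>!l. l < n \<and> ys ! l = xs ! i"
      using that by (metis in_set_conv_nth nth_eq_iff_index_eq)
    from theI'[OF ex] show 1: "idx ys (xs ! i) < n" "ys ! idx ys (xs ! i) = xs ! i"
      by (auto simp: idx_def)
    show "ys ! l = xs ! i \<longleftrightarrow> l = idx ys (xs ! i)" if "l < n" for l
      using ex 1 that by blast
    then show "xs ! i = ys ! l \<longleftrightarrow> l = idx ys (xs ! i)" if "l < n" for l
      using that by metis
  qed
  have P_mult: "P xs ys * A = mat n n (\<lambda>(i, j). A $$ (idx ys (xs ! i), j))"
    and mult_P: "A * P ys xs = mat n n (\<lambda>(i, j). A $$ (i, idx ys (xs ! j)))"
    if "distinct ys" "length xs = n" "length ys = n" "set xs = set ys" "A \<in> carrier_mat n n"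
    for xs ys A
  proof -
    note idx = idx[OF that(1-4)]
    show "P xs ys * A = mat n n (\<lambda>(i, j). A $$ (idx ys (xs ! i), j))"
      using \<open>A \<in> carrier_mat n n\<close>
      by (intro eq_matI) (auto simp: P_def scalar_prod_def idx if_distrib[of "\<lambda>x. x * _"]
        cong: if_cong)
    show "A * P ys xs = mat n n (\<lambda>(i, j). A $$ (i, idx ys (xs ! j)))"
      using \<open>A \<in> carrier_mat n n\<close>
      by (intro eq_matI) (auto simp: P_def scalar_prod_def idx if_distrib[of "\<lambda>x. _ * x"]
        cong: if_cong)
  qed
  have PP: "P xs ys * P ys xs = 1\<^sub>m n"
    if "distinct xs" "distinct ys" "length xs = n" "length ys = n" "set xs = set ys" for xs ys
  proof -
    have "P ys xs \<in> carrier_mat n n" by (simp add: P_def)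
    note P_mult[OF that(2-5) this]
    also have "mat n n (\<lambda>(i, j). P ys xs $$ (idx ys (xs ! i), j)) = 1\<^sub>m n"
    proof (rule eq_matI)
      fix i j assume ij: "i < dim_row (1\<^sub>m n :: complex mat)" "j < dim_col (1\<^sub>m n :: complex mat)"
      then have "idx ys (xs ! i) < n" "ys ! idx ys (xs ! i) = xs ! i"
        using idx(1,2)[OF that(2-5)] by auto
      moreover have "xs ! i = xs ! j \<longleftrightarrow> i = j"
        using ij that by (simp add: nth_eq_iff_index_eq)
      ultimately show "mat n n (\<lambda>(i, j). P ys xs $$ (idx ys (xs ! i), j)) $$ (i, j) = 1\<^sub>m n $$ (i, j)"
        using ij by (simp add: P_def)
    qed auto
    finally show ?thesis .
  qed
  have carr: "adj_mat G vs \<in> carrier_mat n n" "adj_mat G ws \<in> carrier_mat n n"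
    using len by (auto simp: adj_mat_def)
  have Pc: "P xs ys \<in> carrier_mat n n" for xs ys
    by (simp add: P_def)
  have "P vs ws * adj_mat G ws * P ws vs = adj_mat G vs"
  proof -
    let ?B = "mat n n (\<lambda>(i, j). adj_mat G ws $$ (idx ws (vs ! i), j))"
    note idx = idx[OF ws len eq]
    have "P vs ws * adj_mat G ws * P ws vs = ?B * P ws vs"
      by (subst P_mult[OF ws len eq carr(2)]) (rule refl)
    also have "\<dots> = mat n n (\<lambda>(i, j). ?B $$ (i, idx ws (vs ! j)))"
      by (rule mult_P[OF ws len eq]) simp
    also have "\<dots> = adj_mat G vs"
      by (rule eq_matI) (simp_all add: adj_mat_def len idx(1,2))
    finally show ?thesis .
  qed
  then have "similar_mat_wit (adj_mat G vs) (adj_mat G ws) (P vs ws) (P ws vs)"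
    using PP[OF vs ws len eq] PP[OF ws vs len(2,1) eq[symmetric]] carr Pc
    by (intro similar_mat_witI[of _ _ n]) auto
  then show ?thesis
    unfolding similar_mat_def by blast
qed

lemma graph_energy_eq:
  assumes "distinct vs" "set vs = verts G"
  shows "graph_energy G = mat_energy (adj_mat G vs)"
proof -
  let ?ws = "SOME vs. distinct vs \<and> set vs = verts G"
  have "distinct ?ws \<and> set ?ws = verts G"
    by (rule someI[of _ vs]) (use assms in auto)
  then have "similar_mat (adj_mat G ?ws) (adj_mat G vs)"
    using assms by (intro similar_adj_mat) auto
  then show ?thesis
    unfolding graph_energy_def by (rule mat_energy_similar)
qed

end

theory Submission
  imports Defs "Jordan_Normal_Form.Spectral_Radius"
begin

text \<open>Since the trace vanishes, the energy is twice the sum of the positive eigenvalues. A complete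
  multipartite graph \<open>G\<close> has exactly one positive eigenvalue \<open>r\<close>, the root of \<open>\<Sum>t l / (r + t l) = 1\<close>,
  so its energy is \<open>2r\<close>. Let \<open>H = G - uv\<close>.

  If \<open>t i, t j \<ge> 2\<close>, Ky Fan's principle is applied to \<open>H\<close> with the Perron vector of \<open>G\<close> and a vector
  whose sum over each part is zero: deleting the edge costs the first one \<open>2 x u x v\<close> and gives the
  second one \<open>sqrt ((1 - 1 / t i) (1 - 1 / t j))\<close>, which is larger.

  If \<open>t i = 1\<close> and \<open>t j \<ge> 2\<close>, then \<open>H\<close> has two positive eigenvalues, the roots of a secular function
  that changes sign from plus to minus to plus. Unless \<open>k = 2\<close>, or \<open>k = 3\<close> and \<open>t j = 2\<close>, it is
  nonnegative at \<open>1/3\<close> and negative at \<open>r - 1/3\<close>, so that the two roots add up to more than \<open>r\<close>. By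
  concavity it is enough to check this when the other parts are one part of real size, or a
  singleton and one part of real size.

  In the remaining cases \<open>H\<close> is, up to isolated vertices, again complete multipartite, or it is
  \<open>K\<^bsub>1,2,n\<^esub> - e\<close>. There the negative eigenvalues are \<open>-1\<close> and \<open>-\<mu>\<close> with
  \<open>\<mu>\<^sup>2 (\<mu> + 1) = n (3 \<mu> + 1)\<close>, and \<open>1 + \<mu> < r\<close>.\<close>

section \<open>Spectral theorem for real symmetric matrices\<close>

text \<open>A complex eigenvector exists by algebraic closedness. Write it as \<open>a\<close> plus
  i times \<open>b\<close>, with eigenvalue \<open>c\<close>. Symmetry lets
  \<open>b \<bullet> (A *\<^sub>v a)\<close> be evaluated in two ways, which forces
  \<open>Im c * (a \<bullet> a + b \<bullet> b) = 0\<close>. Hence \<open>c\<close> is real, and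
  whichever of \<open>a\<close>, \<open>b\<close> is nonzero can be normalised.\<close>

lemma symmetric_mat_real_eigenvector:
  fixes A :: "real mat"
  assumes A: "A \<in> carrier_mat n n" and sym: "transpose_mat A = A" and n: "n > 0"
  obtains x v where "v \<in> carrier_vec n" "v \<bullet> v = 1" "A *\<^sub>v v = x \<cdot>\<^sub>v v"
proof -
  let ?C = "map_mat complex_of_real A"
  have C: "?C \<in> carrier_mat n n" using A by simp
  obtain c z where "eigenvector ?C z c"
    using spectrum_non_empty[OF C n] by (auto simp: spectrum_def eigenvalue_def)
  then have z: "z \<in> carrier_vec n" "z \<noteq> 0\<^sub>v n" and ev: "?C *\<^sub>v z = c \<cdot>\<^sub>v z"
    using A by (auto simp: eigenvector_def)
  define a b where "a = map_vec Re z" and "b = map_vec Im z"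
  have ab: "a \<in> carrier_vec n" "b \<in> carrier_vec n" using z by (auto simp: a_def b_def)
  have Aa: "A *\<^sub>v a = Re c \<cdot>\<^sub>v a - Im c \<cdot>\<^sub>v b"
  proof (rule eq_vecI)
    fix i assume i: "i < dim_vec (Re c \<cdot>\<^sub>v a - Im c \<cdot>\<^sub>v b)"
    then have i: "i < n" using ab by simp
    have "(A *\<^sub>v a) $ i = Re ((?C *\<^sub>v z) $ i)"
      using i A z by (simp add: scalar_prod_def a_def)
    then show "(A *\<^sub>v a) $ i = (Re c \<cdot>\<^sub>v a - Im c \<cdot>\<^sub>v b) $ i"
      using ev i z ab by (simp add: a_def b_def)
  qed (use A ab in simp)
  have Ab: "A *\<^sub>v b = Re c \<cdot>\<^sub>v b + Im c \<cdot>\<^sub>v a"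
  proof (rule eq_vecI)
    fix i assume i: "i < dim_vec (Re c \<cdot>\<^sub>v b + Im c \<cdot>\<^sub>v a)"
    then have i: "i < n" using ab by simp
    have "(A *\<^sub>v b) $ i = Im ((?C *\<^sub>v z) $ i)"
      using i A z by (simp add: scalar_prod_def b_def)
    then show "(A *\<^sub>v b) $ i = (Re c \<cdot>\<^sub>v b + Im c \<cdot>\<^sub>v a) $ i"
      using ev i z ab by (simp add: a_def b_def)
  qed (use A ab in simp)
  have nonneg: "w \<bullet> w \<ge> 0" "w \<bullet> w = 0 \<Longrightarrow> w = 0\<^sub>v n" if "w \<in> carrier_vec n" for w :: "real vec"
  proof -
    have w: "w \<bullet> w = (\<Sum>i<n. (w $ i)\<^sup>2)"
      using that by (simp add: scalar_prod_def power2_eq_square atLeast0LessThan)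
    then show "w \<bullet> w \<ge> 0" by (simp add: sum_nonneg)
    show "w \<bullet> w = 0 \<Longrightarrow> w = 0\<^sub>v n"
      unfolding w using that by (subst (asm) sum_nonneg_eq_0_iff) (auto intro!: eq_vecI)
  qed
  have "a \<noteq> 0\<^sub>v n \<or> b \<noteq> 0\<^sub>v n"
  proof (rule ccontr)
    assume H: "\<not> ?thesis"
    have "z = 0\<^sub>v n"
    proof (rule eq_vecI)
      fix i assume i: "i < dim_vec (0\<^sub>v n :: complex vec)"
      then have "a $ i = 0" "b $ i = 0" using H by auto
      then show "z $ i = 0\<^sub>v n $ i" using i z by (simp add: a_def b_def complex_eq_iff)
    qed (use z in simp)
    then show False using z by simp
  qed
  then have pos: "a \<bullet> a + b \<bullet> b > 0"
    using nonneg ab by (metis add_nonneg_eq_0_iff add_nonneg_nonneg less_eq_real_def)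
  have "b \<bullet> (A *\<^sub>v a) = (A *\<^sub>v b) \<bullet> a"
    using transpose_vec_mult_scalar[OF A ab(1) ab(2)] sym by simp
  then have "Re c * (b \<bullet> a) - Im c * (b \<bullet> b) = Re c * (b \<bullet> a) + Im c * (a \<bullet> a)"
    unfolding Aa Ab using ab
    by (simp add: scalar_prod_minus_distrib[of _ n] add_scalar_prod_distrib[of _ n])
  then have "Im c * (a \<bullet> a + b \<bullet> b) = 0" by (simp add: algebra_simps)
  then have "Im c = 0" using pos by simp
  then have ev': "A *\<^sub>v a = Re c \<cdot>\<^sub>v a" "A *\<^sub>v b = Re c \<cdot>\<^sub>v b"
    unfolding Aa Ab using ab by (auto intro!: eq_vecI)
  obtain w where w: "w \<in> carrier_vec n" "w \<noteq> 0\<^sub>v n" "A *\<^sub>v w = Re c \<cdot>\<^sub>v w"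
    using \<open>a \<noteq> 0\<^sub>v n \<or> b \<noteq> 0\<^sub>v n\<close> ab ev' by blast
  then have ww: "w \<bullet> w > 0" using nonneg[OF w(1)] by fastforce
  show thesis
  proof
    show "(1 / sqrt (w \<bullet> w)) \<cdot>\<^sub>v w \<in> carrier_vec n" using w by simp
    show "((1 / sqrt (w \<bullet> w)) \<cdot>\<^sub>v w) \<bullet> ((1 / sqrt (w \<bullet> w)) \<cdot>\<^sub>v w) = 1" using w ww by simp
    show "A *\<^sub>v ((1 / sqrt (w \<bullet> w)) \<cdot>\<^sub>v w) = Re c \<cdot>\<^sub>v ((1 / sqrt (w \<bullet> w)) \<cdot>\<^sub>v w)"
      using w A by (simp add: mult_mat_vec smult_smult_assoc mult.commute)
  qed
qed

text \<open>The reflection in the hyperplane orthogonal to \<open>v - unit_vec n 0\<close> exchanges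
  the two unit vectors; it degenerates exactly when they coincide, where the identity serves. It
  supplies the orthogonal change of basis for the deflation in the spectral theorem.\<close>

lemma householder:
  fixes v :: "real vec"
  assumes v: "v \<in> carrier_vec n" and vv: "v \<bullet> v = 1" and n: "n > 0"
  obtains H where "H \<in> carrier_mat n n" "transpose_mat H = H" "H * H = 1\<^sub>m n"
    "col H 0 = v"
proof (cases "v = unit_vec n 0")
  case True
  show ?thesis
    by (rule that[of "1\<^sub>m n"]) (use True n in auto)
next
  case False
  define w where "w = v - unit_vec n 0"
  have w: "w \<in> carrier_vec n" using v by (simp add: w_def)
  define H where "H = mat n n (\<lambda>(i, j). (if i = j then 1 else 0) - 2 * w $ i * w $ j / (w \<bullet> w))"
  have ww: "w \<bullet> w = (\<Sum>k<n. w $ k * w $ k)"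
    using w by (simp add: scalar_prod_def atLeast0LessThan)
  have "w \<noteq> 0\<^sub>v n"
  proof
    assume "w = 0\<^sub>v n"
    then have "v $ i = unit_vec n 0 $ i" if "i < n" for i
      using that v by (auto simp: w_def dest!: arg_cong[of _ _ "\<lambda>x. x $ i"])
    then show False using False v by auto
  qed
  then have ww0: "w \<bullet> w \<noteq> 0"
    unfolding ww using w by (subst sum_nonneg_eq_0_iff) (auto intro!: eq_vecI)
  \<comment> \<open>Both vectors are unit, so the squared length of \<open>w\<close> is linear in
    \<open>v $ 0\<close>; this makes the coefficient in column \<open>0\<close> of \<open>H\<close>
    collapse and leaves \<open>unit_vec n 0 + w = v\<close>.\<close>
  have wv: "w \<bullet> w = 2 - 2 * v $ 0"
    using v vv n by (simp add: w_def scalar_prod_minus_distrib[of _ n] minus_scalar_prod_distrib[of _ n])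
  have w0: "w $ 0 = v $ 0 - 1" using n v by (simp add: w_def)
  show ?thesis
  proof (rule that[of H])
    show "H \<in> carrier_mat n n" by (simp add: H_def)
    show "transpose_mat H = H" by (rule eq_matI) (auto simp: H_def)
    show "H * H = 1\<^sub>m n"
    proof (rule eq_matI)
      fix i j assume "i < dim_row (1\<^sub>m n :: real mat)" "j < dim_col (1\<^sub>m n :: real mat)"
      then have ij: "i < n" "j < n" by auto
      let ?s = "w \<bullet> w"
      have "(H * H) $$ (i, j) = (\<Sum>k<n. H $$ (i, k) * H $$ (k, j))"
        using ij by (simp add: H_def scalar_prod_def atLeast0LessThan)
      also have "\<dots> = (\<Sum>k<n. (if i = k then (if k = j then 1 else 0) - 2 * w $ i * w $ j / ?s else 0)
          - (if k = j then 2 * w $ i * w $ j / ?s else 0)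
          + 4 * w $ i * w $ j / ?s\<^sup>2 * (w $ k * w $ k))"
        by (intro sum.cong refl) (use ij in \<open>auto simp: H_def power2_eq_square algebra_simps\<close>)
      also have "\<dots> = (if i = j then 1 else 0) - 2 * w $ i * w $ j / ?s - 2 * w $ i * w $ j / ?s
          + 4 * w $ i * w $ j / ?s\<^sup>2 * ?s"
        unfolding ww[symmetric] sum.distrib sum_subtractf sum_distrib_left[symmetric]
        using ij by simp
      also have "\<dots> = (if i = j then 1 else 0)"
        using ww0 by (simp add: field_simps power2_eq_square)
      finally show "(H * H) $$ (i, j) = 1\<^sub>m n $$ (i, j)" using ij by simp
    qed (simp_all add: H_def)
    have v01: "v $ 0 - 1 \<noteq> 0" using wv ww0 by auto
    show "col H 0 = v"
    proof (rule eq_vecI)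
      fix i assume "i < dim_vec v"
      then have i: "i < n" using v by simp
      have "col H 0 $ i = (if i = 0 then 1 else 0) - 2 * w $ i * (v $ 0 - 1) / (2 - 2 * v $ 0)"
        using i n by (simp add: H_def w0 wv)
      also have "\<dots> = (if i = 0 then 1 else 0) + w $ i"
        using v01 by (simp add: field_simps)
      also have "\<dots> = v $ i" using i v n by (simp add: w_def)
      finally show "col H 0 $ i = v $ i" .
    qed (use v in \<open>simp add: H_def\<close>)
  qed
qed

lemma mult_block_diag_mat:
  fixes A B C D :: "'a :: comm_ring_1 mat"
  assumes "A \<in> carrier_mat k k" "B \<in> carrier_mat m m"
    and "C \<in> carrier_mat k k" "D \<in> carrier_mat m m"
  shows "four_block_mat A (0\<^sub>m k m) (0\<^sub>m m k) B * four_block_mat C (0\<^sub>m k m) (0\<^sub>m m k) D =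
    four_block_mat (A * C) (0\<^sub>m k m) (0\<^sub>m m k) (B * D)"
  using assms
  by (subst mult_four_block_mat[where ?nr1.0 = k and ?n1.0 = k and ?n2.0 = m and ?nr2.0 = m
        and ?nc1.0 = k and ?nc2.0 = m]) auto

text \<open>Induction by deflation: conjugating with a reflection whose first column is a unit
  eigenvector makes the first column a multiple of the first basis vector. By symmetry the first row
  is too, so the matrix splits into a scalar and a smaller symmetric block.\<close>

theorem symmetric_mat_spectral:
  fixes A :: "real mat"
  assumes "A \<in> carrier_mat n n" and "transpose_mat A = A"
  shows "\<exists>U d. U \<in> carrier_mat n n \<and> transpose_mat U * U = 1\<^sub>m n \<and> A * U = U * mat_diag n d"
  using assms
proof (induction n arbitrary: A)
  case 0
  show ?case
    by (rule exI[of _ "1\<^sub>m 0"]) (use 0 in \<open>auto simp: mat_diag_def intro!: eq_matI exI[of _ "\<lambda>_. 0"]\<close>)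
next
  case (Suc m)
  let ?n = "Suc m"
  note A = Suc.prems(1)
  obtain x v where v: "v \<in> carrier_vec ?n" "v \<bullet> v = 1" "A *\<^sub>v v = x \<cdot>\<^sub>v v"
    by (rule symmetric_mat_real_eigenvector[OF Suc.prems zero_less_Suc])
  obtain H where H: "H \<in> carrier_mat ?n ?n" "transpose_mat H = H" "H * H = 1\<^sub>m ?n" "col H 0 = v"
    by (rule householder[OF v(1,2) zero_less_Suc])
  define M where "M = H * (A * H)"
  have M: "M \<in> carrier_mat ?n ?n" using A H by (simp add: M_def)
  have symM: "transpose_mat M = M"
    using A H(1) by (simp add: M_def transpose_mult[of _ ?n ?n _ ?n] H(2) Suc.prems(2))
  have "col M 0 = x \<cdot>\<^sub>v unit_vec ?n 0"
  proof -
    have "col M 0 = H *\<^sub>v (A *\<^sub>v col H 0)"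
    proof -
      have "col M 0 = H *\<^sub>v col (A * H) 0"
        unfolding M_def by (rule col_mult2[of _ ?n ?n _ ?n]) (use A H(1) in auto)
      moreover have "col (A * H) 0 = A *\<^sub>v col H 0"
        by (rule col_mult2[of _ ?n ?n _ ?n]) (use A H(1) in auto)
      ultimately show ?thesis by (simp only:)
    qed
    also have "\<dots> = x \<cdot>\<^sub>v (H *\<^sub>v col H 0)"
      using H v by (simp add: mult_mat_vec)
    also have "H *\<^sub>v col H 0 = col (H * H) 0"
      by (rule col_mult2[symmetric, of _ ?n ?n _ ?n]) (use H(1) in auto)
    finally show ?thesis by (simp add: H(3))
  qed
  then have M0: "M $$ (i, 0) = (if i = 0 then x else 0)" if "i < ?n" for i
    using that M by (auto dest!: arg_cong[of _ _ "\<lambda>w. w $ i"])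
  have M0': "M $$ (0, i) = (if i = 0 then x else 0)" if "i < ?n" for i
  proof -
    have "M $$ (0, i) = transpose_mat M $$ (i, 0)" using that M by simp
    then show ?thesis using M0[OF that] by (simp add: symM)
  qed
  define N where "N = mat m m (\<lambda>(i, j). M $$ (Suc i, Suc j))"
  have N: "N \<in> carrier_mat m m" by (simp add: N_def)
  have "transpose_mat N = N"
  proof (rule eq_matI)
    fix i j assume "i < dim_row N" "j < dim_col N"
    then have ij: "i < m" "j < m" using N by auto
    have "M $$ (Suc j, Suc i) = transpose_mat M $$ (Suc i, Suc j)" using ij M by simp
    then show "transpose_mat N $$ (i, j) = N $$ (i, j)" using ij by (simp add: N_def symM)
  qed (use N in auto)
  from Suc.IH[OF N this] obtain U d where U: "U \<in> carrier_mat m m" "transpose_mat U * U = 1\<^sub>m m"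
    "N * U = U * mat_diag m d" by auto
  \<comment> \<open>Bordering the diagonalisation of the smaller block diagonalises
    \<open>M\<close>; since \<open>H\<close> is an involution, \<open>H * W\<close> then
    diagonalises \<open>A\<close>.\<close>
  define W where "W = four_block_mat (1\<^sub>m 1) (0\<^sub>m 1 m) (0\<^sub>m m 1) U"
  define D where "D = mat_diag ?n (\<lambda>i. case i of 0 \<Rightarrow> x | Suc i \<Rightarrow> d i)"
  have W: "W \<in> carrier_mat ?n ?n" using U by (auto simp: W_def)
  have Dc: "D \<in> carrier_mat ?n ?n" by (simp add: D_def)
  have M_eq: "M = four_block_mat (x \<cdot>\<^sub>m 1\<^sub>m 1) (0\<^sub>m 1 m) (0\<^sub>m m 1) N"
    by (rule eq_matI) (use M N in \<open>auto simp: M0 M0' N_def\<close>)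
  have D_eq: "D = four_block_mat (x \<cdot>\<^sub>m 1\<^sub>m 1) (0\<^sub>m 1 m) (0\<^sub>m m 1) (mat_diag m d)"
    by (rule eq_matI) (auto simp: D_def mat_diag_def split: nat.splits)
  have MW: "M * W = W * D"
    unfolding M_eq W_def D_eq using N U by (simp add: mult_block_diag_mat)
  have WW: "transpose_mat W * W = 1\<^sub>m ?n"
  proof -
    have "transpose_mat W = four_block_mat (1\<^sub>m 1) (0\<^sub>m 1 m) (0\<^sub>m m 1) (transpose_mat U)"
      unfolding W_def by (rule eq_matI) (use U in auto)
    then have "transpose_mat W * W = four_block_mat (1\<^sub>m 1) (0\<^sub>m 1 m) (0\<^sub>m m 1) (1\<^sub>m m)"
      unfolding W_def using U by (simp add: mult_block_diag_mat)
    then show ?thesis by simp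
  qed
  have "H * W \<in> carrier_mat ?n ?n" using H W by simp
  moreover have "transpose_mat (H * W) * (H * W) = 1\<^sub>m ?n"
  proof -
    have "transpose_mat (H * W) * (H * W) = transpose_mat W * ((H * H) * W)"
      using H(1,2) W by (simp add: transpose_mult[of _ ?n ?n _ ?n] assoc_mult_mat[of _ ?n ?n _ ?n _ ?n])
    then show ?thesis using W WW by (simp add: H(3))
  qed
  moreover have "A * (H * W) = (H * W) * D"
  proof -
    have "A * (H * W) = (H * H) * (A * (H * W))"
      using A H W by (simp add: H(3))
    also have "\<dots> = H * (M * W)"
      using A H(1) W by (simp add: M_def assoc_mult_mat[of _ ?n ?n _ ?n _ ?n])
    also have "\<dots> = (H * W) * D" using H(1) W Dc by (simp add: MW assoc_mult_mat[of _ ?n ?n _ ?n _ ?n])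
    finally show ?thesis .
  qed
  ultimately show ?case unfolding D_def by blast
qed

section \<open>Energy as a sum over an orthonormal eigenbasis\<close>

lemma order_prod_linear_factors:
  fixes c :: "'b \<Rightarrow> 'a :: field"
  assumes "finite I"
  shows "order x (\<Prod>i\<in>I. [:- c i, 1:]) = card {i \<in> I. c i = x}"
  using assms
proof (induction I rule: finite_induct)
  case (insert j I)
  have nz: "[:- c j, 1:] * (\<Prod>i\<in>I. [:- c i, 1:]) \<noteq> 0"
    using insert by (subst mult_eq_0_iff, subst prod_zero_iff) auto
  have "order x (\<Prod>i\<in>insert j I. [:- c i, 1:])
      = order x [:- c j, 1:] + card {i \<in> I. c i = x}"
    by (simp only: prod.insert[OF insert(1,2)] order_mult[OF nz] insert.IH)
  moreover have "order x [:- c j, 1:] = (if c j = x then 1 else 0)"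
    using order_power_n_n[of x 1] by (auto intro: order_0I)
  moreover have "{i \<in> insert j I. c i = x} =
      (if c j = x then insert j {i \<in> I. c i = x} else {i \<in> I. c i = x})" by auto
  ultimately show ?case using insert by auto
qed simp

text \<open>Grouping the indices by the value of \<open>c\<close> turns algebraic multiplicities
  into cardinalities of fibres, so repeated eigenvalues are handled by summing over indices.\<close>

lemma mat_energy_eq_sum_roots:
  assumes A: "A \<in> carrier_mat n n" and I: "finite I"
    and char: "char_poly A = (\<Prod>i\<in>I. [:- c i, 1:])"
  shows "mat_energy A = (\<Sum>i\<in>I. cmod (c i))"
proof -
  have "{x. eigenvalue A x} = c ` I"
    unfolding eigenvalue_root_char_poly[OF A] char using I by (auto simp: poly_prod)
  then have "mat_energy A = (\<Sum>x\<in>c ` I. real (card {i \<in> I. c i = x}) * cmod x)"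
    using I by (simp add: mat_energy_def char order_prod_linear_factors)
  also have "\<dots> = (\<Sum>x\<in>c ` I. \<Sum>i\<in>{i \<in> I. c i = x}. cmod (c i))"
    by (intro sum.cong) auto
  also have "\<dots> = (\<Sum>i\<in>I. cmod (c i))"
    by (rule sum.image_gen[OF I, symmetric])
  finally show ?thesis .
qed

text \<open>Real entries indexed by vertices instead of complex entries indexed by list positions,
  so that quadratic forms are real and independent of an enumeration.\<close>

definition adj :: "'a sgraph \<Rightarrow> 'a \<Rightarrow> 'a \<Rightarrow> real" where
  "adj G x y = (if {x, y} \<in> edges G then 1 else 0)"

lemma adj_commute: "adj G x y = adj G y x"
  by (simp add: adj_def insert_commute)

text \<open>The matrix spectral theorem is moved to functions on vertices. There are as many
  eigenfunctions as vertices, so the vertices also serve as their indices: \<open>v x\<close> is the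
  eigenfunction with number \<open>x\<close>. The two orthogonality relations say that the rows and
  the columns of the eigenvector matrix are orthonormal.\<close>

theorem graph_spectral:
  fixes G :: "'a sgraph"
  assumes fin: "finite (verts G)"
  obtains v :: "'a \<Rightarrow> 'a \<Rightarrow> real" and d :: "'a \<Rightarrow> real" where
    "\<And>x y. x \<in> verts G \<Longrightarrow> y \<in> verts G \<Longrightarrow>
      (\<Sum>z\<in>verts G. v x z * v y z) = (if x = y then 1 else 0)"
    "\<And>x y. x \<in> verts G \<Longrightarrow> y \<in> verts G \<Longrightarrow>
      (\<Sum>z\<in>verts G. v z x * v z y) = (if x = y then 1 else 0)"
    "\<And>x z. x \<in> verts G \<Longrightarrow> z \<in> verts G \<Longrightarrow>
      (\<Sum>w\<in>verts G. adj G z w * v x w) = d x * v x z"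
    "graph_energy G = (\<Sum>x\<in>verts G. \<bar>d x\<bar>)"
proof -
  let ?V = "verts G"
  obtain vs where vs: "distinct vs" "set vs = ?V" using finite_distinct_list[OF fin] by auto
  define n where "n = length vs"
  have bij: "bij_betw ((!) vs) {..<n} ?V" using vs by (simp add: n_def bij_betw_nth)
  have reindex: "(\<Sum>z\<in>?V. F z) = (\<Sum>k<n. F (vs ! k))" for F :: "'a \<Rightarrow> real"
    using sum.reindex_bij_betw[OF bij, of F] by simp
  define idx where "idx = the_inv_into {..<n} ((!) vs)"
  have idx: "idx x < n" "vs ! idx x = x" if "x \<in> ?V" for x
    using bij that unfolding idx_def bij_betw_def
    by (metis lessThan_iff order_refl the_inv_into_into, metis f_the_inv_into_f)
  have idx_nth: "idx (vs ! k) = k" if "k < n" for k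
    using bij that unfolding idx_def bij_betw_def by (simp add: the_inv_into_f_f)
  have idx_eq: "idx x = idx y \<longleftrightarrow> x = y" if "x \<in> ?V" "y \<in> ?V" for x y
    using idx that by metis
  define A where "A = mat n n (\<lambda>(i, j). adj G (vs ! i) (vs ! j))"
  have A: "A \<in> carrier_mat n n" by (simp add: A_def)
  have "transpose_mat A = A"
    by (rule eq_matI) (auto simp: A_def adj_commute)
  from symmetric_mat_spectral[OF A this] obtain U d where U: "U \<in> carrier_mat n n"
    "transpose_mat U * U = 1\<^sub>m n" "A * U = U * mat_diag n d" by auto
  \<comment> \<open>A left inverse of a square matrix is also a right inverse; this yields the
    completeness relation and the similarity to a diagonal matrix.\<close>
  have UU: "U * transpose_mat U = 1\<^sub>m n"
    using mat_mult_left_right_inverse[of "transpose_mat U" n U] U by simp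
  have A_eq: "A = U * mat_diag n d * transpose_mat U"
  proof -
    have "A = A * (U * transpose_mat U)" using A UU by simp
    also have "\<dots> = A * U * transpose_mat U"
      by (rule assoc_mult_mat[symmetric, OF A U(1)]) (use U(1) in simp)
    finally show ?thesis by (simp add: U(3))
  qed
  have "similar_mat A (mat_diag n d)"
    by (rule similar_matI[of _ _ U "transpose_mat U" n]) (use A U UU A_eq in auto)
  then have "char_poly A = char_poly (mat_diag n d)" by (rule char_poly_similar)
  also have "\<dots> = (\<Prod>a\<leftarrow>diag_mat (mat_diag n d). [:- a, 1:])"
    by (rule char_poly_upper_triangular[of _ n]) (auto simp: mat_diag_def)
  also have "diag_mat (mat_diag n d) = map d [0..<n]"
    by (auto simp: diag_mat_def mat_diag_def)
  also have "(\<Prod>a\<leftarrow>map d [0..<n]. [:- a, 1:]) = (\<Prod>i<n. [:- d i, 1:])"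
    by (simp add: prod.distinct_set_conv_list[symmetric] atLeast0LessThan o_def)
  finally have char: "char_poly A = (\<Prod>i<n. [:- d i, 1:])" .
  interpret poly: map_poly_comm_ring_hom complex_of_real ..
  have "char_poly (map_mat complex_of_real A) = (\<Prod>i<n. [:- complex_of_real (d i), 1:])"
    by (simp add: of_real_hom.char_poly_hom[OF A] char poly.hom_prod)
  then have "mat_energy (map_mat complex_of_real A) = (\<Sum>i<n. \<bar>d i\<bar>)"
    using A by (subst mat_energy_eq_sum_roots[of _ n "{..<n}"]) auto
  moreover have "adj_mat G vs = map_mat complex_of_real A"
    by (rule eq_matI) (auto simp: adj_mat_def A_def adj_def n_def)
  ultimately have energy: "graph_energy G = (\<Sum>i<n. \<bar>d i\<bar>)"
    using graph_energy_eq[OF vs] by simp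
  define v where "v x z = U $$ (idx z, idx x)" for x z
  show thesis
  proof (rule that[of v "\<lambda>x. d (idx x)"])
    fix x y assume xy: "x \<in> ?V" "y \<in> ?V"
    have "(\<Sum>z\<in>?V. v x z * v y z) = (transpose_mat U * U) $$ (idx x, idx y)"
      using U(1) idx[OF xy(1)] idx[OF xy(2)]
      by (simp add: reindex v_def idx_nth scalar_prod_def atLeast0LessThan)
    then show "(\<Sum>z\<in>?V. v x z * v y z) = (if x = y then 1 else 0)"
      using U(2) idx xy idx_eq by simp
    have "(\<Sum>z\<in>?V. v z x * v z y) = (U * transpose_mat U) $$ (idx x, idx y)"
      using U(1) idx[OF xy(1)] idx[OF xy(2)]
      by (simp add: reindex v_def idx_nth scalar_prod_def atLeast0LessThan)
    then show "(\<Sum>z\<in>?V. v z x * v z y) = (if x = y then 1 else 0)"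
      using UU idx xy idx_eq by simp
    have "(\<Sum>w\<in>?V. adj G y w * v x w) = (A * U) $$ (idx y, idx x)"
      using U(1) A idx[OF xy(1)] idx[OF xy(2)]
      by (simp add: reindex v_def idx_nth scalar_prod_def atLeast0LessThan A_def)
    also have "\<dots> = d (idx x) * v x y"
      using U(1) idx[OF xy(1)] idx[OF xy(2)]
      by (simp add: U(3) mat_diag_mult_right[of _ n] v_def)
    finally show "(\<Sum>w\<in>?V. adj G y w * v x w) = d (idx x) * v x y" .
  next
    show "graph_energy G = (\<Sum>x\<in>?V. \<bar>d (idx x)\<bar>)"
      using energy by (simp add: reindex idx_nth)
  qed
qed

section \<open>Variational bounds for the energy\<close>

definition qform :: "'a sgraph \<Rightarrow> ('a \<Rightarrow> real) \<Rightarrow> real" where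
  "qform G f = (\<Sum>x\<in>verts G. \<Sum>y\<in>verts G. adj G x y * f x * f y)"

text \<open>Completeness says that the rank-one projections onto the \<open>v z\<close> add up to
  the identity, so the diagonal entries of \<open>M\<close> in this family add up to the
  trace.\<close>

lemma complete_family_trace:
  fixes v :: "'a \<Rightarrow> 'a \<Rightarrow> real"
  assumes fin: "finite V"
    and complete: "\<And>x y. x \<in> V \<Longrightarrow> y \<in> V \<Longrightarrow> (\<Sum>z\<in>V. v z x * v z y) = (if x = y then 1 else 0)"
  shows "(\<Sum>z\<in>V. \<Sum>x\<in>V. \<Sum>y\<in>V. M x y * v z x * v z y) = (\<Sum>x\<in>V. M x x)"
proof -
  have "(\<Sum>z\<in>V. \<Sum>x\<in>V. \<Sum>y\<in>V. M x y * v z x * v z y)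
      = (\<Sum>x\<in>V. \<Sum>y\<in>V. \<Sum>z\<in>V. M x y * v z x * v z y)"
    by (subst sum.swap) (intro sum.cong refl sum.swap)
  also have "\<dots> = (\<Sum>x\<in>V. \<Sum>y\<in>V. M x y * (if x = y then 1 else 0))"
    by (intro sum.cong refl) (simp add: complete[symmetric] sum_distrib_left mult.assoc)
  also have "\<dots> = (\<Sum>x\<in>V. M x x)"
    using fin by (simp add: if_distrib[of "\<lambda>t. _ * t"] cong: if_cong)
  finally show ?thesis .
qed

lemma complete_family_parseval:
  fixes v :: "'a \<Rightarrow> 'a \<Rightarrow> real"
  assumes "finite V"
    and "\<And>x y. x \<in> V \<Longrightarrow> y \<in> V \<Longrightarrow> (\<Sum>z\<in>V. v z x * v z y) = (if x = y then 1 else 0)"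
  shows "(\<Sum>z\<in>V. (\<Sum>x\<in>V. p x * v z x)\<^sup>2) = (\<Sum>x\<in>V. (p x)\<^sup>2)"
  using complete_family_trace[of V v "\<lambda>x y. p x * p y", OF assms]
  by (simp add: power2_eq_square sum_product mult_ac)

text \<open>The spectral data in the form used by the variational bounds. Completeness expands any
  function in the eigenfunctions and so diagonalises the form; the eigenvalues add up to zero
  because a simple graph has no loops.\<close>

lemma energy_spectral:
  assumes G: "simple_graph G"
  obtains v :: "'a \<Rightarrow> 'a \<Rightarrow> real" and d :: "'a \<Rightarrow> real" where
    "\<And>x. x \<in> verts G \<Longrightarrow> (\<Sum>z\<in>verts G. (v x z)\<^sup>2) = 1"
    "\<And>x y. x \<in> verts G \<Longrightarrow> y \<in> verts G \<Longrightarrow>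
      (\<Sum>z\<in>verts G. v z x * v z y) = (if x = y then 1 else 0)"
    "\<And>x. x \<in> verts G \<Longrightarrow> qform G (v x) = d x"
    "\<And>p. qform G p = (\<Sum>x\<in>verts G. d x * (\<Sum>z\<in>verts G. p z * v x z)\<^sup>2)"
    "(\<Sum>x\<in>verts G. d x) = 0"
    "graph_energy G = (\<Sum>x\<in>verts G. \<bar>d x\<bar>)"
proof -
  let ?V = "verts G"
  have fin: "finite ?V" using G by (simp add: simple_graph_def)
  obtain v d where orth: "\<And>x y. x \<in> ?V \<Longrightarrow> y \<in> ?V \<Longrightarrow>
      (\<Sum>z\<in>?V. v x z * v y z) = (if x = y then 1 else 0)"
    and complete: "\<And>x y. x \<in> ?V \<Longrightarrow> y \<in> ?V \<Longrightarrow>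
      (\<Sum>z\<in>?V. v z x * v z y) = (if x = y then 1 else 0)"
    and ev: "\<And>x z. x \<in> ?V \<Longrightarrow> z \<in> ?V \<Longrightarrow>
      (\<Sum>w\<in>?V. adj G z w * v x w) = d x * v x z"
    and energy: "graph_energy G = (\<Sum>x\<in>?V. \<bar>d x\<bar>)"
    by (rule graph_spectral[OF fin]) blast
  have expand: "p w = (\<Sum>x\<in>?V. (\<Sum>z\<in>?V. p z * v x z) * v x w)" if "w \<in> ?V" for p w
  proof -
    have "(\<Sum>x\<in>?V. (\<Sum>z\<in>?V. p z * v x z) * v x w) = (\<Sum>z\<in>?V. \<Sum>x\<in>?V. p z * v x z * v x w)"
      by (subst sum.swap) (simp add: sum_distrib_right)
    also have "\<dots> = (\<Sum>z\<in>?V. p z * (if z = w then 1 else 0))"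
      by (intro sum.cong refl) (simp add: complete[symmetric] that sum_distrib_left mult.assoc)
    also have "\<dots> = p w"
      using fin that by (simp add: if_distrib[of "\<lambda>t. _ * t"] cong: if_cong)
    finally show ?thesis by simp
  qed
  have q: "qform G p = (\<Sum>x\<in>?V. d x * (\<Sum>z\<in>?V. p z * v x z)\<^sup>2)" for p
  proof -
    let ?c = "\<lambda>x. \<Sum>z\<in>?V. p z * v x z"
    have "qform G p = (\<Sum>z\<in>?V. p z * (\<Sum>w\<in>?V. adj G z w * p w))"
      by (simp add: qform_def sum_distrib_left mult_ac)
    also have "\<dots> = (\<Sum>z\<in>?V. p z * (\<Sum>x\<in>?V. ?c x * (d x * v x z)))"
    proof (rule sum.cong[OF refl])
      fix z assume z: "z \<in> ?V"
      have "(\<Sum>w\<in>?V. adj G z w * p w) = (\<Sum>w\<in>?V. \<Sum>x\<in>?V. adj G z w * (?c x * v x w))"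
      proof (rule sum.cong[OF refl])
        fix w assume "w \<in> ?V"
        from expand[OF this, of p]
        show "adj G z w * p w = (\<Sum>x\<in>?V. adj G z w * (?c x * v x w))"
          by (simp only: sum_distrib_left[symmetric])
      qed
      also have "\<dots> = (\<Sum>x\<in>?V. ?c x * (\<Sum>w\<in>?V. adj G z w * v x w))"
        by (subst sum.swap) (simp add: sum_distrib_left mult_ac)
      also have "\<dots> = (\<Sum>x\<in>?V. ?c x * (d x * v x z))"
        using z by (simp add: ev)
      finally show "p z * (\<Sum>w\<in>?V. adj G z w * p w) = p z * (\<Sum>x\<in>?V. ?c x * (d x * v x z))"
        by (simp only:)
    qed
    also have "\<dots> = (\<Sum>x\<in>?V. \<Sum>z\<in>?V. p z * (?c x * (d x * v x z)))"
      by (subst sum.swap) (simp add: sum_distrib_left)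
    also have "\<dots> = (\<Sum>x\<in>?V. d x * (?c x)\<^sup>2)"
    proof (intro sum.cong refl)
      fix x
      have "(\<Sum>z\<in>?V. p z * (?c x * (d x * v x z))) = (\<Sum>z\<in>?V. (?c x * d x) * (p z * v x z))"
        by (simp add: mult_ac)
      also have "\<dots> = d x * (?c x)\<^sup>2"
        unfolding sum_distrib_left[symmetric] by (simp add: power2_eq_square mult_ac)
      finally show "(\<Sum>z\<in>?V. p z * (?c x * (d x * v x z))) = d x * (?c x)\<^sup>2" .
    qed
    finally show ?thesis .
  qed
  have qv: "qform G (v x) = d x" if "x \<in> ?V" for x
  proof -
    have "qform G (v x) = (\<Sum>y\<in>?V. d y * (if x = y then 1 else 0)\<^sup>2)"
      unfolding q by (intro sum.cong refl) (simp add: orth[OF that])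
    also have "\<dots> = d x"
      using fin that by (simp add: if_distrib[of "\<lambda>t. t ^ _"] if_distrib[of "\<lambda>t. _ * t"] cong: if_cong)
    finally show ?thesis .
  qed
  have "(\<Sum>x\<in>?V. d x) = (\<Sum>x\<in>?V. qform G (v x))" by (simp add: qv)
  also have "\<dots> = (\<Sum>x\<in>?V. adj G x x)"
    unfolding qform_def by (rule complete_family_trace[OF fin complete])
  also have "\<dots> = 0"
    using G by (intro sum.neutral) (auto simp: adj_def simple_graph_def doubleton_eq_iff)
  finally have trace: "(\<Sum>x\<in>?V. d x) = 0" .
  show thesis
    by (rule that[of v d]) (use orth complete qv q trace energy in \<open>auto simp: power2_eq_square\<close>)
qed

text \<open>The next two bounds are weak duality for the trace norm: if \<open>A = P - N\<close> with \<open>P\<close> and \<open>N\<close>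
  positive semidefinite and \<open>tr A = 0\<close>, then the energy is at most \<open>2 tr P = 2 tr N\<close>.\<close>

lemma energy_le_of_qform_le:
  assumes G: "simple_graph G"
    and le: "\<And>f. qform G f \<le> (\<Sum>x\<in>verts G. p x * f x)\<^sup>2"
  shows "graph_energy G \<le> 2 * (\<Sum>x\<in>verts G. (p x)\<^sup>2)"
proof -
  let ?V = "verts G"
  have fin: "finite ?V" using G by (simp add: simple_graph_def)
  obtain v d where
    complete: "\<And>x y. x \<in> ?V \<Longrightarrow> y \<in> ?V \<Longrightarrow> (\<Sum>z\<in>?V. v z x * v z y) = (if x = y then 1 else 0)"
    and q: "\<And>x. x \<in> ?V \<Longrightarrow> qform G (v x) = d x" and trace: "(\<Sum>x\<in>?V. d x) = 0"
    and energy: "graph_energy G = (\<Sum>x\<in>?V. \<bar>d x\<bar>)"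
    by (rule energy_spectral[OF G]) blast
  have parseval: "(\<Sum>z\<in>?V. (\<Sum>x\<in>?V. f x * v z x)\<^sup>2) = (\<Sum>x\<in>?V. (f x)\<^sup>2)" for f
    by (rule complete_family_parseval[OF fin]) (rule complete)
  \<comment> \<open>Adding the vanishing trace replaces each \<open>\<bar>d x\<bar>\<close> by twice
    the positive part of \<open>d x\<close>, which the hypothesis bounds at the eigenfunction
    \<open>v x\<close>.\<close>
  have "graph_energy G = (\<Sum>x\<in>?V. \<bar>d x\<bar> + d x)"
    by (simp add: energy sum.distrib trace)
  also have "\<dots> \<le> (\<Sum>x\<in>?V. 2 * (\<Sum>z\<in>?V. p z * v x z)\<^sup>2)"
  proof (rule sum_mono)
    fix x assume "x \<in> ?V"
    then have "d x \<le> (\<Sum>z\<in>?V. p z * v x z)\<^sup>2" using le[of "v x"] q by simp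
    then show "\<bar>d x\<bar> + d x \<le> 2 * (\<Sum>z\<in>?V. p z * v x z)\<^sup>2"
      using zero_le_power2[of "\<Sum>z\<in>?V. p z * v x z"] by linarith
  qed
  also have "\<dots> = 2 * (\<Sum>x\<in>?V. (p x)\<^sup>2)"
    by (simp only: sum_distrib_left[symmetric] parseval)
  finally show ?thesis .
qed

lemma energy_le_of_qform_ge:
  assumes G: "simple_graph G"
    and ge: "\<And>f. qform G f + (\<Sum>x\<in>verts G. p x * f x)\<^sup>2 + (\<Sum>x\<in>verts G. q x * f x)\<^sup>2 \<ge> 0"
  shows "graph_energy G \<le> 2 * ((\<Sum>x\<in>verts G. (p x)\<^sup>2) + (\<Sum>x\<in>verts G. (q x)\<^sup>2))"
proof -
  let ?V = "verts G"
  have fin: "finite ?V" using G by (simp add: simple_graph_def)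
  obtain v d where
    complete: "\<And>x y. x \<in> ?V \<Longrightarrow> y \<in> ?V \<Longrightarrow> (\<Sum>z\<in>?V. v z x * v z y) = (if x = y then 1 else 0)"
    and qv: "\<And>x. x \<in> ?V \<Longrightarrow> qform G (v x) = d x" and trace: "(\<Sum>x\<in>?V. d x) = 0"
    and energy: "graph_energy G = (\<Sum>x\<in>?V. \<bar>d x\<bar>)"
    by (rule energy_spectral[OF G]) blast
  have parseval: "(\<Sum>z\<in>?V. (\<Sum>x\<in>?V. f x * v z x)\<^sup>2) = (\<Sum>x\<in>?V. (f x)\<^sup>2)" for f
    by (rule complete_family_parseval[OF fin]) (rule complete)
  have "graph_energy G = (\<Sum>x\<in>?V. \<bar>d x\<bar> - d x)"
    by (simp add: energy sum_subtractf trace)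
  also have "\<dots> \<le> (\<Sum>x\<in>?V. 2 * (\<Sum>z\<in>?V. p z * v x z)\<^sup>2 + 2 * (\<Sum>z\<in>?V. q z * v x z)\<^sup>2)"
  proof (rule sum_mono)
    fix x assume "x \<in> ?V"
    then have "d x + (\<Sum>z\<in>?V. p z * v x z)\<^sup>2 + (\<Sum>z\<in>?V. q z * v x z)\<^sup>2 \<ge> 0"
      using ge[of "v x"] qv by simp
    then show "\<bar>d x\<bar> - d x \<le> 2 * (\<Sum>z\<in>?V. p z * v x z)\<^sup>2 + 2 * (\<Sum>z\<in>?V. q z * v x z)\<^sup>2"
      using zero_le_power2[of "\<Sum>z\<in>?V. p z * v x z"] zero_le_power2[of "\<Sum>z\<in>?V. q z * v x z"]
      by linarith
  qed
  also have "\<dots> = 2 * ((\<Sum>x\<in>?V. (p x)\<^sup>2) + (\<Sum>x\<in>?V. (q x)\<^sup>2))"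
    by (simp only: sum.distrib sum_distrib_left[symmetric] parseval distrib_left)
  finally show ?thesis .
qed

section \<open>Lower bounds for the energy from orthogonal test functions\<close>

text \<open>Bessel's inequality, from the squared distance of \<open>f\<close> to its projection.
  Norms at most one, rather than equal to one, admit the zero function as a test function.\<close>

lemma bessel2:
  fixes p q f :: "'a \<Rightarrow> real"
  assumes "(\<Sum>x\<in>V. p x * q x) = 0" "(\<Sum>x\<in>V. (p x)\<^sup>2) \<le> 1" "(\<Sum>x\<in>V. (q x)\<^sup>2) \<le> 1"
  shows "(\<Sum>x\<in>V. p x * f x)\<^sup>2 + (\<Sum>x\<in>V. q x * f x)\<^sup>2 \<le> (\<Sum>x\<in>V. (f x)\<^sup>2)"
proof -
  let ?a = "\<Sum>x\<in>V. p x * f x" and ?b = "\<Sum>x\<in>V. q x * f x"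
  have "0 \<le> (\<Sum>x\<in>V. (f x - ?a * p x - ?b * q x)\<^sup>2)" by (simp add: sum_nonneg)
  also have "\<dots> = (\<Sum>x\<in>V. (f x)\<^sup>2 + ?a\<^sup>2 * (p x)\<^sup>2 + ?b\<^sup>2 * (q x)\<^sup>2 - 2 * ?a * (p x * f x)
      - 2 * ?b * (q x * f x) + 2 * ?a * ?b * (p x * q x))"
    by (intro sum.cong refl) (simp add: power2_eq_square algebra_simps)
  also have "\<dots> = (\<Sum>x\<in>V. (f x)\<^sup>2) + ?a\<^sup>2 * (\<Sum>x\<in>V. (p x)\<^sup>2) + ?b\<^sup>2 * (\<Sum>x\<in>V. (q x)\<^sup>2)
      - 2 * ?a * ?a - 2 * ?b * ?b"
    unfolding sum.distrib sum_subtractf sum_distrib_left[symmetric] assms(1) by simp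
  also have "\<dots> \<le> (\<Sum>x\<in>V. (f x)\<^sup>2) + ?a\<^sup>2 * 1 + ?b\<^sup>2 * 1 - 2 * ?a * ?a - 2 * ?b * ?b"
    by (intro diff_mono add_mono mult_left_mono order_refl assms zero_le_power2)
  finally show ?thesis by (simp add: power2_eq_square)
qed

text \<open>Ky Fan's principle for two functions. Their squared coefficients give each eigenvalue a
  weight in \<open>[0, 1]\<close> by Bessel; subtracting the zero trace changes the weights into
  coefficients \<open>2 * w - 1\<close> of absolute value at most one.\<close>

lemma energy_ge_two_unit:
  assumes G: "simple_graph G" and pq: "(\<Sum>x\<in>verts G. p x * q x) = 0"
    and p: "(\<Sum>x\<in>verts G. (p x)\<^sup>2) \<le> 1" and q: "(\<Sum>x\<in>verts G. (q x)\<^sup>2) \<le> 1"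
  shows "2 * (qform G p + qform G q) \<le> graph_energy G"
proof -
  let ?V = "verts G"
  obtain v d where
    norm: "\<And>x. x \<in> ?V \<Longrightarrow> (\<Sum>z\<in>?V. (v x z)\<^sup>2) = 1"
    and qf: "\<And>p. qform G p = (\<Sum>x\<in>?V. d x * (\<Sum>z\<in>?V. p z * v x z)\<^sup>2)"
    and trace: "(\<Sum>x\<in>?V. d x) = 0" and energy: "graph_energy G = (\<Sum>x\<in>?V. \<bar>d x\<bar>)"
    by (rule energy_spectral[OF G]) blast
  let ?w = "\<lambda>x. (\<Sum>z\<in>?V. p z * v x z)\<^sup>2 + (\<Sum>z\<in>?V. q z * v x z)\<^sup>2"
  have "2 * (qform G p + qform G q) = (\<Sum>x\<in>?V. 2 * (d x * ?w x)) - (\<Sum>x\<in>?V. d x)"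
    unfolding qf trace sum.distrib[symmetric] sum_distrib_left
    by (simp add: distrib_left)
  also have "\<dots> = (\<Sum>x\<in>?V. d x * (2 * ?w x - 1))"
    unfolding sum_subtractf[symmetric] by (intro sum.cong refl) (simp add: algebra_simps)
  also have "\<dots> \<le> (\<Sum>x\<in>?V. \<bar>d x\<bar>)"
  proof (rule sum_mono)
    fix x assume "x \<in> ?V"
    then have "?w x \<le> 1" using bessel2[OF pq p q, of "v x"] norm by simp
    moreover have "0 \<le> ?w x" by simp
    moreover have "0 \<le> t \<Longrightarrow> t \<le> 1 \<Longrightarrow> \<bar>2 * t - 1\<bar> \<le> 1" for t :: real by linarith
    ultimately have "\<bar>2 * ?w x - 1\<bar> \<le> 1" by blast
    then have "\<bar>d x\<bar> * \<bar>2 * ?w x - 1\<bar> \<le> \<bar>d x\<bar>" by (rule mult_left_le) simp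
    then show "d x * (2 * ?w x - 1) \<le> \<bar>d x\<bar>"
      unfolding abs_mult[symmetric] by (rule order_trans[OF abs_ge_self])
  qed
  finally show ?thesis by (simp add: energy)
qed

lemma energy_ge_two:
  assumes G: "simple_graph G" and pq: "(\<Sum>x\<in>verts G. p x * q x) = 0"
  shows "2 * (qform G p / (\<Sum>x\<in>verts G. (p x)\<^sup>2) + qform G q / (\<Sum>x\<in>verts G. (q x)\<^sup>2))
    \<le> graph_energy G"
proof -
  let ?n = "\<lambda>f. \<Sum>x\<in>verts G. (f x)\<^sup>2"
  have nonneg: "?n f \<ge> 0" for f :: "'a \<Rightarrow> real" by (simp add: sum_nonneg)
  \<comment> \<open>If \<open>f\<close> vanishes on all vertices, both sides are zero by the
    convention for division by zero, so no nontriviality assumption has to be carried along.\<close>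
  have scale: "qform G (\<lambda>x. f x / sqrt (?n f)) = qform G f / ?n f" for f
  proof -
    have "qform G (\<lambda>x. f x / sqrt (?n f))
        = (\<Sum>x\<in>verts G. \<Sum>y\<in>verts G. adj G x y * f x * f y / (sqrt (?n f) * sqrt (?n f)))"
      by (simp add: qform_def)
    then show ?thesis using nonneg[of f] by (simp add: qform_def sum_divide_distrib)
  qed
  have unit: "?n (\<lambda>x. f x / sqrt (?n f)) \<le> 1" for f :: "'a \<Rightarrow> real"
    using nonneg[of f] by (simp add: power_divide sum_divide_distrib[symmetric] divide_le_eq_1)
  have "(\<Sum>x\<in>verts G. (p x / sqrt (?n p)) * (q x / sqrt (?n q)))
      = (\<Sum>x\<in>verts G. p x * q x) / (sqrt (?n p) * sqrt (?n q))"
    by (simp add: sum_divide_distrib)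
  then have "(\<Sum>x\<in>verts G. (p x / sqrt (?n p)) * (q x / sqrt (?n q))) = 0" using pq by simp
  from energy_ge_two_unit[OF G this unit unit] show ?thesis by (simp only: scale)
qed

lemma energy_ge_rayleigh:
  assumes "simple_graph G"
  shows "2 * (qform G p / (\<Sum>x\<in>verts G. (p x)\<^sup>2)) \<le> graph_energy G"
  using energy_ge_two[OF assms, of p "\<lambda>_. 0"] by (simp add: qform_def)

text \<open>Eigenfunctions of a symmetric operator for distinct eigenvalues are orthogonal, and
  their Rayleigh quotients are the eigenvalues, so the two-function bound applies.\<close>

lemma energy_ge_eigenvalues:
  assumes G: "simple_graph G" and ne: "a \<noteq> b"
    and p: "\<And>x. x \<in> verts G \<Longrightarrow> (\<Sum>y\<in>verts G. adj G x y * p y) = a * p x"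
    and q: "\<And>x. x \<in> verts G \<Longrightarrow> (\<Sum>y\<in>verts G. adj G x y * q y) = b * q x"
    and nz: "\<exists>x\<in>verts G. p x \<noteq> 0" "\<exists>x\<in>verts G. q x \<noteq> 0"
  shows "2 * (a + b) \<le> graph_energy G"
proof -
  let ?V = "verts G"
  have fin: "finite ?V" using G by (simp add: simple_graph_def)
  have rayleigh: "qform G f / (\<Sum>x\<in>?V. (f x)\<^sup>2) = c"
    if "\<And>x. x \<in> ?V \<Longrightarrow> (\<Sum>y\<in>?V. adj G x y * f y) = c * f x" "\<exists>x\<in>?V. f x \<noteq> 0" for f c
  proof -
    have "qform G f = (\<Sum>x\<in>?V. f x * (\<Sum>y\<in>?V. adj G x y * f y))"
      by (simp add: qform_def sum_distrib_left mult_ac)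
    also have "\<dots> = (\<Sum>x\<in>?V. f x * (c * f x))"
      by (intro sum.cong refl) (simp add: that(1))
    also have "\<dots> = c * (\<Sum>x\<in>?V. (f x)\<^sup>2)"
      by (simp add: sum_distrib_left power2_eq_square mult_ac)
    finally have "qform G f = c * (\<Sum>x\<in>?V. (f x)\<^sup>2)" .
    moreover have "(\<Sum>x\<in>?V. (f x)\<^sup>2) \<noteq> 0"
      using fin that(2) by (subst sum_nonneg_eq_0_iff) auto
    ultimately show ?thesis by simp
  qed
  have "(\<Sum>x\<in>?V. q x * (\<Sum>y\<in>?V. adj G x y * p y)) = (\<Sum>x\<in>?V. p x * (\<Sum>y\<in>?V. adj G x y * q y))"
    unfolding sum_distrib_left by (subst sum.swap) (simp add: adj_commute mult_ac)
  then have "(\<Sum>x\<in>?V. q x * (a * p x)) = (\<Sum>x\<in>?V. p x * (b * q x))"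
    by (simp add: p q)
  then have "a * (\<Sum>x\<in>?V. p x * q x) = b * (\<Sum>x\<in>?V. p x * q x)"
    by (simp add: sum_distrib_left mult_ac)
  then have "(\<Sum>x\<in>?V. p x * q x) = 0" using ne by simp
  from energy_ge_two[OF G this] show ?thesis
    by (simp only: rayleigh[OF p nz(1)] rayleigh[OF q nz(2)])
qed

section \<open>Complete multipartite graphs\<close>

text \<open>For \<open>w = t / (r + t)\<close> one has \<open>1 - w = r / (r + t)\<close>, so
  \<open>w - w\<^sup>2 = r * t / (r + t)\<^sup>2\<close>; summing over the parts uses the secular
  equation.\<close>

lemma multipartite_weights_sq:
  fixes t :: "'b \<Rightarrow> real"
  assumes pos: "\<And>l. l \<in> L \<Longrightarrow> t l > 0" and r: "r > 0"
    and eq: "(\<Sum>l\<in>L. t l / (r + t l)) = 1"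
  shows "(\<Sum>l\<in>L. (t l / (r + t l))\<^sup>2) = 1 - r * (\<Sum>l\<in>L. t l / (r + t l)\<^sup>2)"
proof -
  have "(\<Sum>l\<in>L. (t l / (r + t l))\<^sup>2) = (\<Sum>l\<in>L. t l / (r + t l) - r * (t l / (r + t l)\<^sup>2))"
  proof (intro sum.cong refl)
    fix l assume "l \<in> L"
    then have "r + t l > 0" using pos r by (simp add: add_pos_pos)
    then have "t l / (r + t l) = t l * (r + t l) / (r + t l)\<^sup>2"
      by (simp add: power2_eq_square)
    then have "t l / (r + t l) - r * (t l / (r + t l)\<^sup>2) = (t l * (r + t l) - r * t l) / (r + t l)\<^sup>2"
      by (simp add: diff_divide_distrib)
    also have "\<dots> = (t l / (r + t l))\<^sup>2"
      by (simp add: power_divide power2_eq_square algebra_simps)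
    finally show "(t l / (r + t l))\<^sup>2 = t l / (r + t l) - r * (t l / (r + t l)\<^sup>2)" by simp
  qed
  then show ?thesis unfolding sum_subtractf sum_distrib_left[symmetric] eq .
qed

text \<open>Here \<open>s l\<close> stands for the sum of a function over part \<open>l\<close>, and
  the left side is the form of the complete multipartite graph. The Perron function takes the value
  \<open>1 / (r + t l)\<close> on part \<open>l\<close>. Its part sums are the weights
  \<open>w\<close>; splitting \<open>s\<close> into a multiple of \<open>w\<close> and a remainder
  \<open>z\<close> leaves a nonpositive form on \<open>z\<close>, so only one positive direction
  exists.\<close>

lemma multipartite_form_le:
  fixes t s :: "'b \<Rightarrow> real"
  assumes pos: "\<And>l. l \<in> L \<Longrightarrow> t l > 0" and r: "r > 0"
    and eq: "(\<Sum>l\<in>L. t l / (r + t l)) = 1"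
  defines "N \<equiv> (\<Sum>l\<in>L. t l / (r + t l)\<^sup>2)"
  shows "(\<Sum>l\<in>L. s l)\<^sup>2 - (\<Sum>l\<in>L. (s l)\<^sup>2) \<le> r / N * (\<Sum>l\<in>L. s l / (r + t l))\<^sup>2"
proof -
  let ?g = "\<lambda>l. 1 / (r + t l)"
  define w where "w l = t l / (r + t l)" for l
  have w: "0 \<le> w l" "w l \<le> 1" "w l = 1 - r * ?g l" if "l \<in> L" for l
    using pos[OF that] r by (auto simp: w_def field_simps)
  have fin: "finite L" using eq by (metis sum.infinite zero_neq_one)
  have "L \<noteq> {}" using eq by auto
  then have N: "N > 0"
    unfolding N_def using pos r fin by (intro sum_pos divide_pos_pos zero_less_power add_pos_pos) auto
  define h where "h = (\<Sum>l\<in>L. s l * ?g l)"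
  define a where "a = h / N"
  define z where "z l = s l - a * w l" for l
  define Z where "Z = (\<Sum>l\<in>L. z l)"
  have wg: "(\<Sum>l\<in>L. w l * ?g l) = N"
    by (simp add: N_def w_def power2_eq_square)
  have sw: "(\<Sum>l\<in>L. w l) = 1" using eq by (simp add: w_def)
  have zg: "(\<Sum>l\<in>L. z l * ?g l) = 0"
  proof -
    have "(\<Sum>l\<in>L. z l * ?g l) = (\<Sum>l\<in>L. s l * ?g l) - a * (\<Sum>l\<in>L. w l * ?g l)"
      by (simp add: z_def left_diff_distrib diff_divide_distrib sum_subtractf sum_distrib_left)
    then show ?thesis using N by (simp add: wg[simplified] h_def a_def)
  qed
  \<comment> \<open>Since \<open>w l = 1 - r / (r + t l)\<close>, the condition \<open>zg\<close>
    makes the weighted mean of \<open>z\<close> equal to its plain sum.\<close>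
  have zw: "(\<Sum>l\<in>L. w l * z l) = Z"
  proof -
    have "(\<Sum>l\<in>L. w l * z l) = (\<Sum>l\<in>L. z l - r * (z l * ?g l))"
      by (intro sum.cong refl) (simp add: w(3) algebra_simps)
    also have "\<dots> = (\<Sum>l\<in>L. z l) - r * (\<Sum>l\<in>L. z l * ?g l)"
      unfolding sum_subtractf sum_distrib_left ..
    finally show ?thesis unfolding zg by (simp add: Z_def)
  qed
  have ww: "(\<Sum>l\<in>L. (w l)\<^sup>2) = 1 - r * N"
    unfolding N_def w_def by (rule multipartite_weights_sq[OF pos r eq])
  have "(\<Sum>l\<in>L. s l) = (\<Sum>l\<in>L. z l + a * w l)" by (simp add: z_def)
  then have S: "(\<Sum>l\<in>L. s l) = Z + a"
    by (simp add: sum.distrib sum_distrib_left[symmetric] sw Z_def)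
  have "(\<Sum>l\<in>L. (s l)\<^sup>2) = (\<Sum>l\<in>L. (z l)\<^sup>2 + 2 * a * (w l * z l) + a\<^sup>2 * (w l)\<^sup>2)"
    by (intro sum.cong refl) (simp add: z_def power2_eq_square algebra_simps)
  then have S2: "(\<Sum>l\<in>L. (s l)\<^sup>2) = (\<Sum>l\<in>L. (z l)\<^sup>2) + 2 * a * Z + a\<^sup>2 * (1 - r * N)"
    by (simp add: sum.distrib sum_distrib_left[symmetric] zw ww)
  \<comment> \<open>Jensen's inequality for the probability weights \<open>w\<close>, followed by
    \<open>w l \<le> 1\<close>.\<close>
  have "Z\<^sup>2 \<le> (\<Sum>l\<in>L. (z l)\<^sup>2)"
  proof -
    have "0 \<le> (\<Sum>l\<in>L. w l * (z l - Z)\<^sup>2)" by (intro sum_nonneg mult_nonneg_nonneg w) auto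
    also have "\<dots> = (\<Sum>l\<in>L. w l * (z l)\<^sup>2 - 2 * Z * (w l * z l) + Z\<^sup>2 * w l)"
      by (intro sum.cong refl) (simp add: power2_eq_square algebra_simps)
    also have "\<dots> = (\<Sum>l\<in>L. w l * (z l)\<^sup>2) - Z\<^sup>2"
      by (simp add: sum.distrib sum_subtractf sum_distrib_left[symmetric] zw sw power2_eq_square)
    also have "(\<Sum>l\<in>L. w l * (z l)\<^sup>2) \<le> (\<Sum>l\<in>L. (z l)\<^sup>2)"
      by (intro sum_mono mult_left_le_one_le w) auto
    finally show ?thesis by simp
  qed
  then have "(\<Sum>l\<in>L. s l)\<^sup>2 - (\<Sum>l\<in>L. (s l)\<^sup>2) \<le> a\<^sup>2 * r * N"
    unfolding S S2 by (simp add: power2_eq_square algebra_simps)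
  also have "\<dots> = r / N * h\<^sup>2" using N by (simp add: a_def power2_eq_square)
  finally show ?thesis by (simp add: h_def)
qed

text \<open>The secular sum equals the number of parts at \<open>0\<close> and is at most
  \<open>1\<close> at the total size \<open>T\<close>, where every denominator is at least
  \<open>T\<close>; the intermediate value theorem gives the root.\<close>

lemma multipartite_root_exists:
  fixes t :: "'b \<Rightarrow> real"
  assumes fin: "finite L" and card: "card L \<ge> 2" and pos: "\<And>l. l \<in> L \<Longrightarrow> t l > 0"
  obtains r where "r > 0" "(\<Sum>l\<in>L. t l / (r + t l)) = 1"
proof -
  let ?F = "\<lambda>r. \<Sum>l\<in>L. t l / (r + t l)"
  define T where "T = (\<Sum>l\<in>L. t l)"
  have "L \<noteq> {}" using card by auto
  then have T: "T > 0" unfolding T_def using fin pos by (intro sum_pos) auto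
  have "?F T \<le> (\<Sum>l\<in>L. t l / T)"
    using pos T by (intro sum_mono divide_left_mono mult_pos_pos add_pos_pos) (auto intro: less_imp_le)
  also have "\<dots> = 1" using T by (simp add: sum_divide_distrib[symmetric] T_def[symmetric])
  finally have hi: "?F T \<le> 1" .
  have "?F 0 = (\<Sum>l\<in>L. 1)" by (intro sum.cong refl) (use pos in fastforce)
  then have lo: "?F 0 = real (card L)" by simp
  have "continuous_on {0..T} ?F"
    by (intro continuous_intros) (use pos in \<open>fastforce simp: add_nonneg_eq_0_iff\<close>)
  then obtain r where r: "0 \<le> r" "r \<le> T" "?F r = 1"
    using IVT2'[of ?F T 1 0] hi lo card T by auto
  moreover have "r \<noteq> 0" using r lo card by auto
  ultimately show thesis using that[of r] by auto
qed

lemma sum_by_class: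
  assumes "finite U"
  shows "(\<Sum>x\<in>U. F x) = (\<Sum>l\<in>c ` U. \<Sum>x\<in>{x \<in> U. c x = l}. F x)"
  by (rule sum.image_gen[OF assms])

text \<open>The parts are the colour classes of \<open>c\<close> on \<open>U\<close>, and the
  vertices outside \<open>U\<close> are isolated. This generality covers both the original graph and
  those edge-deleted graphs that are again complete multipartite up to isolated vertices. The form
  counts all ordered pairs in \<open>U\<close> and subtracts the monochromatic ones.\<close>

lemma qform_multipartite:
  assumes G: "simple_graph G" and U: "U \<subseteq> verts G"
    and adj: "\<And>x y. x \<in> verts G \<Longrightarrow> y \<in> verts G \<Longrightarrow>
      {x, y} \<in> edges G \<longleftrightarrow> x \<in> U \<and> y \<in> U \<and> c x \<noteq> c y"
  shows "qform G f = (\<Sum>x\<in>U. f x)\<^sup>2 - (\<Sum>l\<in>c ` U. (\<Sum>x\<in>{x \<in> U. c x = l}. f x)\<^sup>2)"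
proof -
  have fin: "finite (verts G)" using G by (simp add: simple_graph_def)
  then have finU: "finite U" using U finite_subset by blast
  let ?s = "\<lambda>l. \<Sum>x\<in>{x \<in> U. c x = l}. f x"
  have "qform G f = (\<Sum>x\<in>U. \<Sum>y\<in>U. adj G x y * f x * f y)"
  proof -
    have "(\<Sum>y\<in>verts G. adj G x y * f x * f y) = (\<Sum>y\<in>U. adj G x y * f x * f y)" if "x \<in> verts G" for x
      by (rule sum.mono_neutral_right[OF fin U]) (use that in \<open>auto simp: adj_def adj\<close>)
    then have "qform G f = (\<Sum>x\<in>verts G. \<Sum>y\<in>U. adj G x y * f x * f y)"
      by (simp add: qform_def)
    also have "\<dots> = (\<Sum>x\<in>U. \<Sum>y\<in>U. adj G x y * f x * f y)"
      by (rule sum.mono_neutral_right[OF fin U]) (use U in \<open>auto simp: adj_def adj subset_iff intro!: sum.neutral\<close>)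
    finally show ?thesis .
  qed
  also have "\<dots> = (\<Sum>x\<in>U. \<Sum>y\<in>U. f x * f y - (if c y = c x then f x * f y else 0))"
    by (intro sum.cong refl) (use U in \<open>auto simp: adj_def adj subset_iff\<close>)
  also have "\<dots> = (\<Sum>x\<in>U. f x)\<^sup>2 - (\<Sum>x\<in>U. \<Sum>y\<in>U. if c y = c x then f x * f y else 0)"
    by (simp add: sum_subtractf power2_eq_square sum_product)
  also have "(\<Sum>x\<in>U. \<Sum>y\<in>U. if c y = c x then f x * f y else 0) = (\<Sum>x\<in>U. f x * ?s (c x))"
    using finU by (simp add: sum.inter_filter[symmetric] sum_distrib_left)
  also have "\<dots> = (\<Sum>l\<in>c ` U. \<Sum>x\<in>{x \<in> U. c x = l}. f x * ?s (c x))"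
    by (rule sum_by_class[OF finU])
  also have "\<dots> = (\<Sum>l\<in>c ` U. (?s l)\<^sup>2)"
  proof (rule sum.cong[OF refl])
    fix l
    have "(\<Sum>x\<in>{x \<in> U. c x = l}. f x * ?s (c x)) = (\<Sum>x\<in>{x \<in> U. c x = l}. f x * ?s l)"
      by (rule sum.cong) auto
    then show "(\<Sum>x\<in>{x \<in> U. c x = l}. f x * ?s (c x)) = (?s l)\<^sup>2"
      by (simp add: power2_eq_square sum_distrib_right)
  qed
  finally show ?thesis .
qed

text \<open>The Perron function \<open>g\<close> has squared norm \<open>N\<close>. The form is at
  most the rank-one form of \<open>sqrt (r / N) * g\<close>, whose trace is \<open>r\<close>, and
  the Rayleigh quotient of \<open>g\<close> is \<open>r\<close>; the upper and lower energy bounds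
  therefore meet at \<open>2 * r\<close>.\<close>

theorem energy_multipartite:
  fixes G :: "'a sgraph" and c :: "'a \<Rightarrow> 'b"
  assumes G: "simple_graph G" and U: "U \<subseteq> verts G"
    and adj: "\<And>x y. x \<in> verts G \<Longrightarrow> y \<in> verts G \<Longrightarrow>
      {x, y} \<in> edges G \<longleftrightarrow> x \<in> U \<and> y \<in> U \<and> c x \<noteq> c y"
    and t: "\<And>l. t l = real (card {x \<in> U. c x = l})"
    and r: "r > 0" and eq: "(\<Sum>l\<in>c ` U. t l / (r + t l)) = 1"
  shows "graph_energy G = 2 * r"
proof (rule antisym)
  have fin: "finite (verts G)" using G by (simp add: simple_graph_def)
  then have finU: "finite U" using U finite_subset by blast
  let ?L = "c ` U"
  have q: "qform G f = (\<Sum>x\<in>U. f x)\<^sup>2 - (\<Sum>l\<in>?L. (\<Sum>x\<in>{x \<in> U. c x = l}. f x)\<^sup>2)" for f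
    by (rule qform_multipartite[OF G U]) (rule adj)
  define g where "g x = (if x \<in> U then 1 / (r + t (c x)) else 0)" for x
  define N where "N = (\<Sum>l\<in>?L. t l / (r + t l)\<^sup>2)"
  have t_pos: "t l > 0" if "l \<in> ?L" for l
    using that finU by (auto simp: t card_gt_0_iff)
  have "?L \<noteq> {}" using eq by auto
  then have N: "N > 0"
    unfolding N_def using t_pos r finU by (intro sum_pos divide_pos_pos zero_less_power add_pos_pos) auto
  have sum_U: "(\<Sum>x\<in>verts G. F x * g x) = (\<Sum>x\<in>U. F x * g x)" for F
    by (rule sum.mono_neutral_right[OF fin U]) (simp add: g_def)
  have sum_g: "(\<Sum>x\<in>verts G. F x * g x) = (\<Sum>l\<in>?L. (\<Sum>x\<in>{x \<in> U. c x = l}. F x) / (r + t l))" for F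
  proof -
    have "(\<Sum>x\<in>U. F x * g x) = (\<Sum>l\<in>?L. \<Sum>x\<in>{x \<in> U. c x = l}. F x * g x)"
      by (rule sum_by_class[OF finU])
    also have "\<dots> = (\<Sum>l\<in>?L. (\<Sum>x\<in>{x \<in> U. c x = l}. F x) / (r + t l))"
      by (rule sum.cong[OF refl], subst sum_divide_distrib, rule sum.cong[OF refl]) (auto simp: g_def)
    finally show ?thesis by (simp add: sum_U)
  qed
  have s_g: "(\<Sum>x\<in>{x \<in> U. c x = l}. g x) = t l / (r + t l)" for l
  proof -
    have "(\<Sum>x\<in>{x \<in> U. c x = l}. g x) = (\<Sum>x\<in>{x \<in> U. c x = l}. 1 / (r + t l))"
      by (rule sum.cong) (auto simp: g_def)
    then show ?thesis by (simp add: t)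
  qed
  have gg: "(\<Sum>x\<in>verts G. (g x)\<^sup>2) = N"
    using sum_g[of g] by (simp add: s_g N_def power2_eq_square)
  show "graph_energy G \<le> 2 * r"
  proof -
    have "graph_energy G \<le> 2 * (\<Sum>x\<in>verts G. (sqrt (r / N) * g x)\<^sup>2)"
    proof (rule energy_le_of_qform_le[OF G])
      fix f :: "'a \<Rightarrow> real"
      let ?s = "\<lambda>l. \<Sum>x\<in>{x \<in> U. c x = l}. f x"
      have "qform G f = (\<Sum>l\<in>?L. ?s l)\<^sup>2 - (\<Sum>l\<in>?L. (?s l)\<^sup>2)"
        unfolding q sum_by_class[OF finU, of f c] ..
      also have "\<dots> \<le> r / N * (\<Sum>l\<in>?L. ?s l / (r + t l))\<^sup>2"
        unfolding N_def by (rule multipartite_form_le[OF t_pos r eq])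
      also have "(\<Sum>l\<in>?L. ?s l / (r + t l)) = (\<Sum>x\<in>verts G. f x * g x)"
        by (rule sum_g[symmetric])
      also have "r / N * (\<Sum>x\<in>verts G. f x * g x)\<^sup>2 = (\<Sum>x\<in>verts G. sqrt (r / N) * g x * f x)\<^sup>2"
        using r N by (simp add: sum_distrib_left[symmetric] mult.assoc power_mult_distrib mult.commute[of "g _"])
      finally show "qform G f \<le> (\<Sum>x\<in>verts G. sqrt (r / N) * g x * f x)\<^sup>2" .
    qed
    also have "(\<Sum>x\<in>verts G. (sqrt (r / N) * g x)\<^sup>2) = r"
      unfolding power_mult_distrib sum_distrib_left[symmetric] gg using r N by simp
    finally show ?thesis .
  qed
  have "(\<Sum>x\<in>U. g x) = 1"
    unfolding sum_by_class[OF finU, of g c] s_g eq ..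
  moreover have "(\<Sum>l\<in>?L. (t l / (r + t l))\<^sup>2) = 1 - r * N"
    unfolding N_def by (rule multipartite_weights_sq[OF t_pos r eq])
  ultimately have "qform G g = r * N"
    unfolding q s_g by simp
  then show "2 * r \<le> graph_energy G"
    using energy_ge_rayleigh[OF G, of g] N by (simp add: gg)
qed

section \<open>Inequalities for the secular equation\<close>

text \<open>The concave function \<open>rw / (x + (r - x)w)\<close> takes \<open>t / (r + t)\<close> to \<open>t / (x + t)\<close>.\<close>

definition transfer :: "real \<Rightarrow> real \<Rightarrow> real \<Rightarrow> real" where
  "transfer r x w = r * w / (x + (r - x) * w)"

lemma transfer_weight:
  assumes "r > 0" "x > 0" "t > 0"
  shows "transfer r x (t / (r + t)) = t / (x + t)"
proof -
  have "x + (r - x) * (t / (r + t)) = r * (x + t) / (r + t)"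
    using assms by (simp add: field_simps)
  then show ?thesis using assms by (simp add: transfer_def)
qed

text \<open>A concave function vanishing at zero is subadditive; concretely, enlarging the weight in
  the denominator to the total only decreases each quotient.\<close>

lemma transfer_sum_le:
  assumes r: "x > 0" "x \<le> r" and w: "\<And>l. l \<in> L \<Longrightarrow> w l \<ge> 0" and fin: "finite L"
  shows "transfer r x (\<Sum>l\<in>L. w l) \<le> (\<Sum>l\<in>L. transfer r x (w l))"
proof -
  let ?W = "\<Sum>l\<in>L. w l"
  have "transfer r x ?W = (\<Sum>l\<in>L. r * w l / (x + (r - x) * ?W))"
    by (simp add: transfer_def sum_distrib_left sum_divide_distrib)
  also have "\<dots> \<le> (\<Sum>l\<in>L. transfer r x (w l))"
    unfolding transfer_def
  proof (rule sum_mono)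
    fix l assume l: "l \<in> L"
    have "w l \<le> ?W" using fin l w by (intro member_le_sum) auto
    then have "x + (r - x) * w l \<le> x + (r - x) * ?W" using r by (simp add: mult_left_mono)
    moreover have "x + (r - x) * w l > 0" using r w[OF l] by (simp add: add_pos_nonneg)
    ultimately show "r * w l / (x + (r - x) * ?W) \<le> r * w l / (x + (r - x) * w l)"
      using r w[OF l] by (intro divide_left_mono mult_pos_pos) auto
  qed
  finally show ?thesis .
qed

lemma transfer_diff:
  assumes "x > 0" "x \<le> r" "a \<ge> 0" "b \<ge> 0"
  shows "transfer r x b - transfer r x a
    = r * x * (b - a) / ((x + (r - x) * a) * (x + (r - x) * b))"
proof -
  have "x + (r - x) * a > 0" "x + (r - x) * b > 0" using assms by (simp_all add: add_pos_nonneg)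
  then show ?thesis unfolding transfer_def by (simp add: diff_frac_eq algebra_simps)
qed

text \<open>Concavity in the form needed for moving weight: replacing \<open>a\<close> and
  \<open>b\<close> by the more extreme pair \<open>c\<close> and \<open>a + b - c\<close> lowers the
  sum. Two increments over intervals of the same length \<open>a - c\<close> are compared.\<close>

lemma transfer_spread:
  assumes r: "x > 0" "x \<le> r" and c: "0 \<le> c" "c \<le> a" "c \<le> b"
  shows "transfer r x c + transfer r x (a + b - c) \<le> transfer r x a + transfer r x b"
proof -
  let ?d = "\<lambda>w. x + (r - x) * w"
  have pos: "?d w > 0" if "w \<ge> 0" for w using r that by (simp add: add_pos_nonneg)
  have mono: "?d w \<le> ?d w'" if "w \<le> w'" for w w' using r that by (simp add: mult_left_mono)
  have "transfer r x (a + b - c) - transfer r x b = r * x * (a - c) / (?d b * ?d (a + b - c))"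
    using transfer_diff[of x r b "a + b - c"] r c by simp
  also have "\<dots> \<le> r * x * (a - c) / (?d c * ?d a)"
  proof (rule divide_left_mono)
    show "?d c * ?d a \<le> ?d b * ?d (a + b - c)"
      using pos c by (intro mult_mono mono) (auto intro: less_imp_le)
    show "0 \<le> r * x * (a - c)" using r c by simp
    show "0 < ?d b * ?d (a + b - c) * (?d c * ?d a)" using pos c by (intro mult_pos_pos) auto
  qed
  also have "\<dots> = transfer r x a - transfer r x c"
    using transfer_diff[of x r c a] r c by simp
  finally show ?thesis by simp
qed

text \<open>This is \<open>secular x < 0\<close> with denominators cleared, for
  \<open>m = t j\<close> and all remaining parts merged into one of real size. Shifting both
  variables by \<open>3\<close> leaves a polynomial with positive coefficients only.\<close>

lemma secular_ineq_large_part: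
  fixes m r :: real
  assumes m: "m \<ge> 3" and r: "r \<ge> 3"
  defines "x \<equiv> r - 1/3"
  shows "x * (x\<^sup>2 - (m - 1)) * (r * (r\<^sup>2 - m) + x * ((m + 1) * r + 2 * m))
    < r * (r\<^sup>2 - m) * (x^3 + (m + 1) * x\<^sup>2 + (m - 1) * x - (m - 1))"
proof -
  define p q where "p = r - 3" and "q = m - 3"
  have pq: "p \<ge> 0" "q \<ge> 0" using m r by (simp_all add: p_def q_def)
  have eqs: "r = 3 + p" "m = 3 + q" "x = 8/3 + p" by (simp_all add: p_def q_def x_def)
  have "r * (r\<^sup>2 - m) * (x^3 + (m + 1) * x\<^sup>2 + (m - 1) * x - (m - 1))
      - x * (x\<^sup>2 - (m - 1)) * (r * (r\<^sup>2 - m) + x * ((m + 1) * r + 2 * m))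
      = 2/3 * (p^4 * q) + 2/3 * p^4 + 67/9 * (p^3 * q) + 58/9 * p^3 + 823/27 * (p\<^sup>2 * q)
        + 574/27 * p\<^sup>2 + 1/3 * (p * q\<^sup>2) + 4514/81 * (p * q) + 2264/81 * p + 11/9 * q\<^sup>2
        + 3316/81 * q + 124/9"
    unfolding eqs by (simp add: field_simps power2_eq_square power3_eq_cube power4_eq_xxxx)
  moreover have "\<dots> > 0" using pq by (intro add_nonneg_pos add_nonneg_nonneg mult_nonneg_nonneg) auto
  ultimately show ?thesis by linarith
qed

text \<open>The corresponding inequality for \<open>t j = 2\<close>, with the remaining parts
  replaced by a singleton and one part of real size. Shifting \<open>r\<close> by
  \<open>18/5\<close> makes all coefficients positive.\<close>

lemma secular_ineq_four_parts:
  fixes r :: real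
  assumes r: "r \<ge> 18/5"
  defines "x \<equiv> r - 1/3"
  defines "D \<equiv> r * (r\<^sup>2 - r - 4) + x * (4 * r + 6)"
  shows "x * (x - 1) * (x + 1) * D < (D + (x + 1) * (r * (r\<^sup>2 - r - 4))) * (x\<^sup>2 + 2 * x - 1)"
proof -
  define p where "p = r - 18/5"
  have p: "p \<ge> 0" using r by (simp add: p_def)
  have eqs: "r = 18/5 + p" "x = 49/15 + p" by (simp_all add: p_def x_def)
  have "(D + (x + 1) * (r * (r\<^sup>2 - r - 4))) * (x\<^sup>2 + 2 * x - 1) - x * (x - 1) * (x + 1) * D
      = 2/3 * p^4 + 392/45 * p^3 + 25462/675 * p\<^sup>2 + 569392/10125 * p + 198028/16875"
    unfolding D_def eqs by (simp add: field_simps power2_eq_square power3_eq_cube power4_eq_xxxx)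
  moreover have "\<dots> > 0" using p by (intro add_nonneg_pos add_nonneg_nonneg mult_nonneg_nonneg) auto
  ultimately show ?thesis by linarith
qed

text \<open>For \<open>K_{1,2,n}\<close> minus an edge, \<open>a\<close> is the mean over the twin
  vertices, \<open>y\<close> the value at the vertex left without its neighbour \<open>u\<close>,
  and \<open>s\<close> the sum over the part of size \<open>n\<close>. The values
  \<open>1 / (\<mu> + 1)\<close>, \<open>1 / \<mu>\<close> and \<open>-1 / n\<close> form an
  eigenfunction for \<open>-\<mu>\<close> with squared norm \<open>N\<close>; adding its rank-one
  form cancels the remaining negative direction.\<close>

lemma one_two_form_nonneg:
  fixes \<mu> n a y s :: real
  assumes \<mu>: "\<mu> > 0" and n: "n > 0" and root: "\<mu>\<^sup>2 * (\<mu> + 1) = n * (3 * \<mu> + 1)"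
  defines "N \<equiv> 2 / (\<mu> + 1)\<^sup>2 + 1 / \<mu>\<^sup>2 + 1 / n"
  shows "0 \<le> 2 * a\<^sup>2 + 2 * s * (2 * a + y) + \<mu> / N * (2 * a / (\<mu> + 1) + y / \<mu> - s / n)\<^sup>2"
proof -
  define b g where "b = 1 / (\<mu> + 1)" and "g = 1 / \<mu>"
  define P where "P = 2 * a * b + y * g - s / n"
  have bg: "\<mu> * g = 1" "\<mu> * b = 1 - b" using \<mu> by (simp_all add: b_def g_def field_simps)
  have "(3 * \<mu> + 1) * (g\<^sup>2 * b) = 2 * (\<mu> * g) * g * b + (\<mu> * b + b) * g\<^sup>2"
    by (simp add: algebra_simps power2_eq_square)
  moreover have "\<mu>\<^sup>2 * (\<mu> + 1) * (g\<^sup>2 * b) = (\<mu> * g)\<^sup>2 * (\<mu> * b + b)"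
    by (simp add: algebra_simps power2_eq_square)
  ultimately have "n * (2 * b * g + g\<^sup>2) = 1"
    using root unfolding bg by (simp add: mult.assoc mult.commute[of b g])
  then have inv_n: "1 / n = 2 * b * g + g\<^sup>2" using n by (simp add: field_simps)
  have N: "N = 2 * b\<^sup>2 + g\<^sup>2 + 1 / n" by (simp add: N_def b_def g_def power_divide)
  have "N > 0" unfolding N_def using \<mu> n by (intro add_pos_pos) auto
  have "\<mu> * N = 2 * (\<mu> * b) * b + (\<mu> * g) * g + 2 * (\<mu> * g) * b + (\<mu> * g) * g"
    unfolding N inv_n by (simp add: power2_eq_square algebra_simps)
  also have "\<dots> = 4 * b + 2 * g - 2 * b\<^sup>2" unfolding bg by (simp add: power2_eq_square algebra_simps)
  finally have muN: "\<mu> * N = 4 * b + 2 * g - 2 * b\<^sup>2" .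
  have "\<mu> * P = 2 * a * (\<mu> * b) + y * (\<mu> * g) - s * \<mu> * (1 / n)" by (simp add: P_def algebra_simps)
  also have "s * \<mu> * (1 / n) = s * (2 * (\<mu> * g) * b + (\<mu> * g) * g)"
    unfolding inv_n by (simp add: power2_eq_square algebra_simps)
  finally have muP: "\<mu> * P = 2 * a * (1 - b) + y - s * (2 * b + g)" unfolding bg by simp
  \<comment> \<open>An explicit sum of squares; the relations \<open>muN\<close> and
    \<open>muP\<close>, which encode the cubic for \<open>\<mu>\<close>, turn its expansion into the
    claimed expression.\<close>
  have "0 \<le> 2 * (a + s * b)\<^sup>2 + \<mu> / N * (N * s + P)\<^sup>2" using \<mu> \<open>N > 0\<close> by simp
  also have "\<dots> = 2 * (a + s * b)\<^sup>2 + (\<mu> * N) * s\<^sup>2 + 2 * (\<mu> * P) * s + \<mu> / N * P\<^sup>2"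
    using \<open>N > 0\<close> by (simp add: power2_eq_square field_simps)
  also have "\<dots> = 2 * a\<^sup>2 + 2 * s * (2 * a + y) + \<mu> / N * P\<^sup>2"
    unfolding muN muP by (simp add: power2_eq_square algebra_simps)
  finally show ?thesis by (simp add: P_def b_def g_def)
qed

text \<open>The secular equation of \<open>K_{1,2,n}\<close> reads
  \<open>n * (3 * r + 4) = r^3 - 2 * r\<close>. Substituting it shows that the cubic for
  \<open>\<mu>\<close>, multiplied by \<open>3 * r + 4\<close>, takes the value
  \<open>r\<^sup>2\<close> at \<open>r - 1\<close>. It is negative at \<open>0\<close>, so a root
  lies strictly below \<open>r - 1\<close>.\<close>

lemma one_two_root:
  fixes r n :: real
  assumes r: "r > 0" and n: "n > 0" and eq: "1 / (r + 1) + 2 / (r + 2) + n / (r + n) = 1"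
  obtains \<mu> where "\<mu> > 0" "\<mu> + 1 < r" "\<mu>\<^sup>2 * (\<mu> + 1) = n * (3 * \<mu> + 1)"
proof -
  have "p * (b * c) + q * (a * c) + w * (a * b) = a * b * c"
    if "p / a + q / b + w / c = 1" "a > 0" "b > 0" "c > 0" for a b c p q w :: real
    using that by (simp add: field_simps)
  from this[OF eq] have "(r + 2) * (r + n) + 2 * ((r + 1) * (r + n)) + n * ((r + 1) * (r + 2))
      = (r + 1) * (r + 2) * (r + n)"
    using r n by simp
  then have cubic: "n * (3 * r + 4) = r^3 - 2 * r" by (simp add: algebra_simps power3_eq_cube)
  have "n * (3 * r + 4) > 0" using r n by simp
  then have "r * (r * r - 2) > 0" using cubic by (simp add: algebra_simps power3_eq_cube)
  then have "r * r > 2" using r by (simp add: zero_less_mult_iff)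
  have r1: "r > 1"
  proof (rule ccontr)
    assume "\<not> r > 1"
    then have "r * r \<le> 1 * 1" using r by (intro mult_mono) auto
    then show False using \<open>r * r > 2\<close> by simp
  qed
  let ?f = "\<lambda>z. z\<^sup>2 * (z + 1) - n * (3 * z + 1)"
  have "(3 * r + 4) * ?f (r - 1) = (3 * r + 4) * (r - 1)\<^sup>2 * r - (n * (3 * r + 4)) * (3 * r - 2)"
    by (simp add: algebra_simps)
  also have "\<dots> = r\<^sup>2" unfolding cubic by (simp add: algebra_simps power2_eq_square power3_eq_cube)
  finally have "(3 * r + 4) * ?f (r - 1) > 0" using r by simp
  then have hi: "?f (r - 1) > 0" using r by (simp add: zero_less_mult_iff)
  have lo: "?f 0 < 0" using n by simp
  obtain \<mu> where \<mu>: "0 \<le> \<mu>" "\<mu> \<le> r - 1" "?f \<mu> = 0"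
    using IVT'[of ?f 0 0 "r - 1"] hi lo r1 by (force intro!: continuous_intros)
  have "\<mu> \<noteq> 0" "\<mu> \<noteq> r - 1" using \<mu>(3) hi lo by auto
  then show thesis using \<mu> by (intro that[of \<mu>]) auto
qed

section \<open>Deleting an edge\<close>

lemma verts_complete_multipartite:
  "x \<in> verts (complete_multipartite k t) \<longleftrightarrow> fst x \<in> {1..k} \<and> x \<in> part t (fst x)"
  by (cases x) (auto simp: complete_multipartite_def part_def)

lemma edges_complete_multipartite:
  assumes "x \<in> verts (complete_multipartite k t)" "y \<in> verts (complete_multipartite k t)"
  shows "{x, y} \<in> edges (complete_multipartite k t) \<longleftrightarrow> fst x \<noteq> fst y"
proof
  assume "{x, y} \<in> edges (complete_multipartite k t)"
  then show "fst x \<noteq> fst y"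
    by (auto simp: complete_multipartite_def part_def doubleton_eq_iff)
next
  assume "fst x \<noteq> fst y"
  moreover have "fst x \<in> {1..k}" "x \<in> part t (fst x)" "fst y \<in> {1..k}" "y \<in> part t (fst y)"
    using assms by (simp_all only: verts_complete_multipartite)
  ultimately show "{x, y} \<in> edges (complete_multipartite k t)"
    by (simp only: complete_multipartite_def sgraph.select_convs mem_Collect_eq) blast
qed

lemma finite_part [simp]: "finite (part t l)"
  by (simp add: part_def)

lemma card_part [simp]: "card (part t l) = t l"
  by (simp add: part_def card_cartesian_product)

lemma sum_part_one:
  fixes f :: "nat \<times> nat \<Rightarrow> real"
  assumes w: "w \<in> part t l" and b: "\<And>x. x \<in> part t l \<Longrightarrow> x \<noteq> w \<Longrightarrow> f x = b"
  shows "(\<Sum>x\<in>part t l. f x) = f w + (real (t l) - 1) * b"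
proof -
  have "t l \<noteq> 0" using w by (auto simp: part_def)
  have "(\<Sum>x\<in>part t l. f x) = f w + (\<Sum>x\<in>part t l - {w}. f x)"
    using w by (simp add: sum.remove)
  also have "(\<Sum>x\<in>part t l - {w}. f x) = (\<Sum>x\<in>part t l - {w}. b)"
    by (intro sum.cong refl) (use b in auto)
  finally show ?thesis using w \<open>t l \<noteq> 0\<close> by (simp add: of_nat_diff)
qed

text \<open>The two ends of the edge enter symmetrically; exchanging them later allows each case to
  fix which of the two parts is the smaller one.\<close>

locale multipartite_edge =
  fixes k :: nat and t :: "nat \<Rightarrow> nat" and i j :: nat and u v :: "nat \<times> nat"
  assumes t_pos: "\<And>l. l \<in> {1..k} \<Longrightarrow> t l > 0"
    and ij: "i \<in> {1..k}" "j \<in> {1..k}" "i \<noteq> j"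
    and uv: "u \<in> part t i" "v \<in> part t j"
begin

abbreviation "G \<equiv> complete_multipartite k t"
abbreviation "H \<equiv> delete_edge G {u, v}"
abbreviation "V \<equiv> verts G"
abbreviation "rest \<equiv> {1..k} - {i, j}"

lemma simple [simp]: "simple_graph G" "simple_graph H"
  by (simp_all add: simple_graph_complete_multipartite simple_graph_delete_edge)

lemma verts_H [simp]: "verts H = V"
  by (simp add: delete_edge_def)

lemma finite_V [simp]: "finite V"
  using simple(1) by (simp add: simple_graph_def)

lemma fst_uv [simp]: "fst u = i" "fst v = j" "u \<noteq> v" "v \<noteq> u"
  using uv ij by (auto simp: part_def)

lemma uv_V [simp]: "u \<in> V" "v \<in> V"
  using uv ij by (simp_all add: verts_complete_multipartite)

lemma edges_H: "x \<in> V \<Longrightarrow> y \<in> V \<Longrightarrow>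
    {x, y} \<in> edges H \<longleftrightarrow> fst x \<noteq> fst y \<and> (x, y) \<noteq> (u, v) \<and> (x, y) \<noteq> (v, u)"
  by (auto simp: delete_edge_def edges_complete_multipartite doubleton_eq_iff)

lemma class_eq: "l \<in> {1..k} \<Longrightarrow> {x \<in> V. fst x = l} = part t l"
  by (auto simp: verts_complete_multipartite) (auto simp: part_def)

lemma fst_V: "fst ` V = {1..k}"
proof -
  have "(l, 1) \<in> V" if "l \<in> {1..k}" for l
    using t_pos[OF that] that by (simp add: verts_complete_multipartite part_def)
  then have "l \<in> fst ` V" if "l \<in> {1..k}" for l using that by (metis fst_conv imageI)
  moreover have "fst ` V \<subseteq> {1..k}" by (auto simp: verts_complete_multipartite)
  ultimately show ?thesis by blast
qed

lemma sum_V: "(\<Sum>x\<in>V. f x) = (\<Sum>l=1..k. \<Sum>x\<in>part t l. f x)"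
  unfolding sum_by_class[OF finite_V, of f fst] fst_V by (simp add: class_eq)

lemma sum_classes: "(\<Sum>l=1..k. f l) = f i + f j + (\<Sum>l\<in>rest. f l)" for f :: "nat \<Rightarrow> real"
proof -
  have "sum f {1..k} = f i + sum f ({1..k} - {i})" using ij by (intro sum.remove) auto
  also have "sum f ({1..k} - {i}) = f j + sum f ({1..k} - {i} - {j})" using ij by (intro sum.remove) auto
  also have "{1..k} - {i} - {j} = rest" by auto
  finally show ?thesis by (simp only: add.assoc)
qed

lemma sum_V_split: "(\<Sum>x\<in>V. f x) =
    (\<Sum>x\<in>part t i. f x) + (\<Sum>x\<in>part t j. f x) + (\<Sum>l\<in>rest. \<Sum>x\<in>part t l. f x)"
  for f :: "nat \<times> nat \<Rightarrow> real"
  unfolding sum_V sum_classes ..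

lemma adj_H_sum:
  assumes x: "x \<in> V"
  shows "(\<Sum>y\<in>V. adj H x y * f y) = (\<Sum>y\<in>V. f y) - (\<Sum>y\<in>part t (fst x). f y)
    - (if x = u then f v else 0) - (if x = v then f u else 0)"
proof -
  have "(\<Sum>y\<in>V. adj H x y * f y) = (\<Sum>y\<in>V. f y - (if fst y = fst x then f y else 0)
      - (if y = v then (if x = u then f y else 0) else 0)
      - (if y = u then (if x = v then f y else 0) else 0))"
  proof (rule sum.cong[OF refl])
    fix y assume y: "y \<in> V"
    have "adj H x y = (if fst x \<noteq> fst y \<and> (x, y) \<noteq> (u, v) \<and> (x, y) \<noteq> (v, u) then 1 else 0)"
      by (simp only: adj_def edges_H[OF x y])
    then show "adj H x y * f y = f y - (if fst y = fst x then f y else 0)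
      - (if y = v then (if x = u then f y else 0) else 0)
      - (if y = u then (if x = v then f y else 0) else 0)"
      using ij(3) by (cases "x = u"; cases "x = v"; cases "y = u"; cases "y = v")
        auto
  qed
  also have "\<dots> = (\<Sum>y\<in>V. f y) - (\<Sum>y\<in>{y \<in> V. fst y = fst x}. f y)
      - (if x = u then f v else 0) - (if x = v then f u else 0)"
    by (simp add: sum_subtractf sum.inter_filter)
  also have "{y \<in> V. fst y = fst x} = part t (fst x)"
    using x by (intro class_eq) (simp add: verts_complete_multipartite)
  finally show ?thesis .
qed

lemma qform_H:
  "qform H f = (\<Sum>x\<in>V. f x)\<^sup>2 - (\<Sum>l=1..k. (\<Sum>x\<in>part t l. f x)\<^sup>2) - 2 * f u * f v"
proof -
  let ?s = "\<lambda>l. \<Sum>x\<in>part t l. f x"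
  have "qform H f = (\<Sum>x\<in>V. f x * (\<Sum>y\<in>V. adj H x y * f y))"
    by (simp add: qform_def sum_distrib_left mult_ac)
  also have "\<dots> = (\<Sum>x\<in>V. f x * (\<Sum>y\<in>V. f y) - f x * ?s (fst x)
      - (if x = u then f x * f v else 0) - (if x = v then f x * f u else 0))"
    by (rule sum.cong[OF refl]) (auto simp: adj_H_sum right_diff_distrib)
  also have "\<dots> = (\<Sum>x\<in>V. f x)\<^sup>2 - (\<Sum>x\<in>V. f x * ?s (fst x)) - 2 * f u * f v"
    by (simp add: sum_subtractf sum_distrib_right[symmetric] power2_eq_square)
  also have "(\<Sum>x\<in>V. f x * ?s (fst x)) = (\<Sum>l=1..k. (?s l)\<^sup>2)"
    unfolding sum_V
  proof (rule sum.cong[OF refl])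
    fix l
    have "(\<Sum>x\<in>part t l. f x * ?s (fst x)) = (\<Sum>x\<in>part t l. f x * ?s l)"
      by (rule sum.cong[OF refl]) (auto simp: part_def)
    then show "(\<Sum>x\<in>part t l. f x * ?s (fst x)) = (?s l)\<^sup>2"
      by (simp add: power2_eq_square sum_distrib_right)
  qed
  finally show ?thesis .
qed

lemma energy_G:
  assumes "r > 0" "(\<Sum>l=1..k. real (t l) / (r + real (t l))) = 1"
  shows "graph_energy G = 2 * r"
proof (rule energy_multipartite[where U = V and c = fst and t = "\<lambda>l. real (card {x \<in> V. fst x = l})"])
  show "(\<Sum>l\<in>fst ` V. real (card {x \<in> V. fst x = l}) / (r + real (card {x \<in> V. fst x = l}))) = 1"
    using assms(2) by (simp add: fst_V class_eq)
qed (use assms in \<open>auto simp: edges_complete_multipartite\<close>)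

lemma energy_G_root:
  obtains r where "r > 0" "(\<Sum>l=1..k. real (t l) / (r + real (t l))) = 1" "graph_energy G = 2 * r"
proof -
  have "card {i, j} \<le> card {1..k}" using ij by (intro card_mono) auto
  then have "card {1..k} \<ge> 2" using ij by simp
  then obtain r where "r > 0" "(\<Sum>l=1..k. real (t l) / (r + real (t l))) = 1"
    using multipartite_root_exists[of "{1..k}" "\<lambda>l. real (t l)"] t_pos by auto
  with energy_G[OF this] show thesis using that by blast
qed

section \<open>Edge deletions that leave a complete multipartite graph up to isolated
  vertices\<close>

lemma part_singleton: "t l = 1 \<Longrightarrow> x \<in> part t l \<Longrightarrow> part t l = {x}"
  using card_part[of t l] by (metis card_1_singletonE singletonD)

text \<open>Without the edge, the two singletons form one part of size two. In the secular sum this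
  replaces \<open>2 / (r + 1)\<close> by the smaller \<open>2 / (r + 2)\<close>, which pushes the
  root down.\<close>

lemma energy_decreases_one_one:
  assumes t1: "t i = 1" "t j = 1"
  shows "graph_energy H < graph_energy G"
proof -
  obtain r where r: "r > 0" "(\<Sum>l=1..k. real (t l) / (r + real (t l))) = 1"
    and G: "graph_energy G = 2 * r" by (rule energy_G_root)
  have parts: "part t i = {u}" "part t j = {v}" using part_singleton uv t1 by auto
  show ?thesis
  proof (cases "rest = {}")
    case True
    \<comment> \<open>With no further parts the graph loses its only edge, and the zero function
      bounds the form.\<close>
    have "qform H f = 0" for f
      unfolding qform_H sum_V_split sum_classes True parts by (simp add: power2_eq_square algebra_simps)
    then have "graph_energy H \<le> 2 * (\<Sum>x\<in>verts H. 0\<^sup>2)"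
      by (intro energy_le_of_qform_le) auto
    then show ?thesis using G r by simp
  next
    case False
    define T where "T l = (if l = i then 2 else real (t l))" for l
    let ?L = "{1..k} - {j}"
    have sum_L: "(\<Sum>l\<in>?L. f l) = f i + (\<Sum>l\<in>rest. f l)" for f :: "nat \<Rightarrow> real"
    proof -
      have "sum f ?L = f i + sum f (?L - {i})" using ij by (intro sum.remove) auto
      also have "?L - {i} = rest" by auto
      finally show ?thesis .
    qed
    have "card ?L \<ge> 2"
    proof -
      have "card (insert i rest) \<le> card ?L" using ij by (intro card_mono) auto
      moreover have "card rest > 0" using False by (simp add: card_gt_0_iff)
      ultimately show ?thesis by simp
    qed
    moreover have "T l > 0" if "l \<in> ?L" for l using t_pos[of l] that by (simp add: T_def)
    ultimately obtain s where s: "s > 0" "(\<Sum>l\<in>?L. T l / (s + T l)) = 1"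
      using multipartite_root_exists[of ?L T] by (metis finite_Diff finite_atLeastAtMost)
    \<comment> \<open>Recolouring \<open>v\<close> with \<open>i\<close> realises the merged part;
      the index \<open>j\<close> disappears and \<open>T\<close> records size two at
      \<open>i\<close>.\<close>
    define c where "c x = (if x = v then i else fst x)" for x
    have V_iff: "x \<in> V \<longleftrightarrow> x = u \<or> x = v \<or> (fst x \<in> rest \<and> x \<in> V)" for x
      using parts ij by (auto simp: verts_complete_multipartite)
    have class_c: "{x \<in> V. c x = l} = (if l = i then {u, v} else part t l)" if "l \<in> ?L" for l
    proof (cases "l = i")
      case True
      have "x \<in> {x \<in> V. c x = l} \<longleftrightarrow> x \<in> {u, v}" for x
        using V_iff[of x] True by (cases "x = v"; cases "x = u") (simp_all add: c_def, metis Diff_iff insertI1)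
      then show ?thesis using True by auto
    next
      case False
      have "x \<in> V \<and> c x = l \<longleftrightarrow> x \<in> V \<and> fst x = l" for x
        using False that by (cases "x = v") (simp_all add: c_def)
      then have "{x \<in> V. c x = l} = {x \<in> V. fst x = l}" by simp
      then show ?thesis using False that by (simp add: class_eq)
    qed
    have c_img: "c ` V = ?L"
    proof
      have "c x \<in> ?L" if "x \<in> V" for x
        using V_iff[of x] that ij by (cases "x = v"; cases "x = u") (simp_all add: c_def)
      then show "c ` V \<subseteq> ?L" by blast
      show "?L \<subseteq> c ` V"
      proof
        fix l assume l: "l \<in> ?L"
        have "{x \<in> V. c x = l} \<noteq> {}" using t_pos[of l] l
          unfolding class_c[OF l] by (auto simp: part_def)
        then show "l \<in> c ` V" by auto
      qed
    qed
    have "graph_energy H = 2 * s"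
    proof (rule energy_multipartite[where U = V and c = c and t = "\<lambda>l. real (card {x \<in> V. c x = l})"])
      have "(\<Sum>l\<in>?L. real (card {x \<in> V. c x = l}) / (s + real (card {x \<in> V. c x = l})))
          = (\<Sum>l\<in>?L. T l / (s + T l))"
        by (rule sum.cong[OF refl]) (simp add: class_c T_def)
      then show "(\<Sum>l\<in>c ` V. real (card {x \<in> V. c x = l}) / (s + real (card {x \<in> V. c x = l}))) = 1"
        unfolding c_img using s(2) by (simp only:)
    next
      fix x y assume "x \<in> verts H" "y \<in> verts H"
      then have xy: "x \<in> V" "y \<in> V" by simp_all
      then show "{x, y} \<in> edges H \<longleftrightarrow> x \<in> V \<and> y \<in> V \<and> c x \<noteq> c y"
        using V_iff[of x] V_iff[of y] ij by (auto simp: edges_H c_def)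
    qed (use s in auto)
    moreover have "s < r"
    proof (rule ccontr)
      assume "\<not> s < r"
      \<comment> \<open>The secular sum decreases in its argument: \<open>s\<close> not below
        \<open>r\<close> would make it less than one at \<open>s\<close>.\<close>
      then have "(\<Sum>l\<in>?L. T l / (s + T l)) \<le> (\<Sum>l\<in>?L. T l / (r + T l))"
        using r t_pos s by (intro sum_mono divide_left_mono mult_pos_pos add_pos_pos) (auto simp: T_def)
      also have "\<dots> = 2 / (r + 2) + (\<Sum>l\<in>rest. real (t l) / (r + real (t l)))"
        unfolding sum_L by (auto simp: T_def intro!: sum.cong)
      also have "\<dots> < 2 / (r + 1) + (\<Sum>l\<in>rest. real (t l) / (r + real (t l)))"
        using r by (simp add: divide_strict_left_mono)
      also have "\<dots> = 1" using r(2) unfolding sum_classes t1 by simp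
      finally show False using s by simp
    qed
    ultimately show ?thesis using G by simp
  qed
qed

text \<open>The graph is a star and deleting the edge isolates the leaf \<open>v\<close>. What
  remains is a star with \<open>m = t j - 1\<close> leaves, so the positive eigenvalue drops from
  \<open>sqrt (t j)\<close> to \<open>sqrt m\<close>.\<close>

lemma energy_decreases_star:
  assumes k: "k = 2" and ti: "t i = 1" and tj: "t j \<ge> 2"
  shows "graph_energy H < graph_energy G"
proof -
  obtain r where r: "r > 0" "(\<Sum>l=1..k. real (t l) / (r + real (t l))) = 1"
    and G: "graph_energy G = 2 * r" by (rule energy_G_root)
  have rest: "rest = {}" using k ij by auto
  have all: "{1..k} = {i, j}" using rest ij by blast
  have parts: "part t i = {u}" using part_singleton uv ti by auto
  let ?U = "V - {v}"
  define m where "m = real (t j) - 1"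
  have m: "m \<ge> 1" using tj by (simp add: m_def)
  have class_U: "{x \<in> ?U. fst x = i} = {u}" "{x \<in> ?U. fst x = j} = part t j - {v}"
  proof -
    have "{x \<in> ?U. fst x = l} = {x \<in> V. fst x = l} - {v}" for l by auto
    then show "{x \<in> ?U. fst x = i} = {u}" "{x \<in> ?U. fst x = j} = part t j - {v}"
      using class_eq[OF ij(1)] class_eq[OF ij(2)] parts fst_uv by simp_all
  qed
  have card_U: "real (card {x \<in> ?U. fst x = i}) = 1" "real (card {x \<in> ?U. fst x = j}) = m"
    unfolding class_U using uv tj by (simp_all add: m_def of_nat_diff)
  have "fst ` ?U = {i, j}"
  proof
    show "fst ` ?U \<subseteq> {i, j}" using fst_V all by auto
    have "{x \<in> ?U. fst x = i} \<noteq> {}"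
      using card_U(1) by (metis card.empty of_nat_0 zero_neq_one)
    moreover have "{x \<in> ?U. fst x = j} \<noteq> {}"
      using card_U(2) m by (metis card.empty of_nat_0 not_one_le_zero)
    ultimately show "{i, j} \<subseteq> fst ` ?U" by blast
  qed
  note img = this
  define s where "s = sqrt m"
  have s: "s > 0" "s * s = m" using m by (simp_all add: s_def)
  have "graph_energy H = 2 * s"
  proof (rule energy_multipartite[where U = ?U and c = fst and t = "\<lambda>l. real (card {x \<in> ?U. fst x = l})"])
    have "1 / (s + 1) + m / (s + m) = 1"
    proof -
      have "m / (s + m) = (s * s) / (s * (s + 1))" by (simp add: s(2)[symmetric] algebra_simps)
      then have "1 / (s + 1) + m / (s + m) = (1 + s) / (s + 1)" using s(1) by (simp add: add_divide_distrib)
      then show ?thesis using s(1) by simp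
    qed
    moreover have "sum F {i, j} = F i + F j" for F :: "nat \<Rightarrow> real" using ij(3) by simp
    ultimately show "(\<Sum>l\<in>fst ` ?U. real (card {x \<in> ?U. fst x = l}) / (s + real (card {x \<in> ?U. fst x = l}))) = 1"
      by (simp only: img card_U)
  next
    fix x y assume "x \<in> verts H" "y \<in> verts H"
    then have xy: "x \<in> V" "y \<in> V" by simp_all
    have "fst z = i \<and> z = u \<or> fst z = j \<and> z \<noteq> u" if "z \<in> V" for z
    proof -
      have "fst z = i \<or> fst z = j" using that fst_V all by auto
      moreover have "fst z = i \<Longrightarrow> z = u" using that class_eq[OF ij(1)] parts by blast
      ultimately show ?thesis using ij(3) by auto
    qed
    from this[OF xy(1)] this[OF xy(2)]
    show "{x, y} \<in> edges H \<longleftrightarrow> x \<in> ?U \<and> y \<in> ?U \<and> fst x \<noteq> fst y"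
      unfolding edges_H[OF xy] using xy ij(3)
      by (cases "x = u"; cases "y = u"; cases "x = v"; cases "y = v") simp_all
  qed (use s in auto)
  moreover have "s < r"
  proof -
    have "1 / (r + 1) + real (t j) / (r + real (t j)) = 1"
      using r(2) unfolding sum_classes rest ti by simp
    then have "r * r = real (t j)" using r tj by (simp add: field_simps add_eq_0_iff)
    then have "s * s < r * r" using s by (simp add: m_def)
    then show ?thesis using r(1) s(1) by (metis less_imp_le power2_eq_square power_less_imp_less_base)
  qed
  ultimately show ?thesis using G by simp
qed

section \<open>Edges between two parts of size at least two\<close>

lemma sum_part_const:
  fixes f :: "nat \<times> nat \<Rightarrow> real"
  assumes "\<And>x. x \<in> part t l \<Longrightarrow> f x = b"
  shows "(\<Sum>x\<in>part t l. f x) = real (t l) * b"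
  using assms by simp

lemma fst_part: "x \<in> part t l \<Longrightarrow> fst x = l"
  by (auto simp: part_def)

lemma uv_notin: "v \<notin> part t i" "u \<notin> part t j"
  using fst_part fst_uv ij(3) by metis+

text \<open>The Perron function \<open>p\<close> and a function \<open>q\<close> with zero sum over
  each part are orthogonal. On \<open>q\<close> only the deleted edge contributes to the form, and
  choosing opposite signs at \<open>u\<close> and \<open>v\<close> makes that contribution positive.
  The gain outweighs the loss at \<open>p\<close> by the inequality of arithmetic and geometric
  means; \<open>K_{2,2}\<close> is the case of equality and is excluded by
  \<open>big\<close>.\<close>

lemma energy_increases_both_ge_2:
  assumes ti: "t i \<ge> 2" and tj: "t j \<ge> 2" and big: "rest \<noteq> {} \<or> t i \<ge> 3 \<or> t j \<ge> 3"
  shows "graph_energy H > graph_energy G"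
proof -
  obtain r where r: "r > 0" "(\<Sum>l=1..k. real (t l) / (r + real (t l))) = 1"
    and G: "graph_energy G = 2 * r" by (rule energy_G_root)
  define a b where "a = real (t i)" and "b = real (t j)"
  have ab: "a \<ge> 2" "b \<ge> 2" using ti tj by (simp_all add: a_def b_def)
  define N where "N = (\<Sum>l=1..k. real (t l) / (r + real (t l))\<^sup>2)"
  define \<gamma> where "\<gamma> l = 1 / (r + real (t l))" for l
  define p where "p x = \<gamma> (fst x)" for x :: "nat \<times> nat"
  \<comment> \<open>\<open>A\<close> and \<open>B\<close> are the squared norms of the centred
    indicator functions of \<open>u\<close> and \<open>v\<close> in their parts; dividing by their
    roots gives \<open>q\<close> squared norm one on each part.\<close>
  define A B where "A = (a - 1) / a" and "B = (b - 1) / b"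
  have AB: "A > 0" "B > 0" using ab by (simp_all add: A_def B_def)
  define q where "q x = (if fst x = i then ((if x = u then 1 else 0) - 1 / a) / sqrt A
    else if fst x = j then - (((if x = v then 1 else 0) - 1 / b) / sqrt B) else 0)" for x
  have q_i: "q u = A / sqrt A" "x \<in> part t i \<Longrightarrow> x \<noteq> u \<Longrightarrow> q x = - (1 / a) / sqrt A" for x
    using ab by (auto simp: q_def A_def fst_part diff_divide_distrib)
  have q_j: "q v = - (B / sqrt B)" "x \<in> part t j \<Longrightarrow> x \<noteq> v \<Longrightarrow> q x = 1 / b / sqrt B" for x
    using ab ij(3) by (auto simp: q_def B_def fst_part diff_divide_distrib)
  have q_rest: "q x = 0" if "x \<in> part t l" "l \<in> rest" for x l
    using that by (auto simp: q_def fst_part)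
  have s_i: "(\<Sum>x\<in>part t i. q x) = 0"
    by (subst sum_part_one[OF uv(1) q_i(2)])
      (use ab in \<open>auto simp: q_i(1) A_def a_def[symmetric] field_simps\<close>)
  have s_j: "(\<Sum>x\<in>part t j. q x) = 0"
    by (subst sum_part_one[OF uv(2) q_j(2)])
      (use ab in \<open>auto simp: q_j(1) B_def b_def[symmetric] field_simps\<close>)
  have s_rest: "(\<Sum>x\<in>part t l. q x) = 0" if "l \<in> rest" for l
    using q_rest[OF _ that] by simp
  have s: "(\<Sum>x\<in>part t l. q x) = 0" if "l \<in> {1..k}" for l
  proof -
    have "l = i \<or> l = j \<or> l \<in> rest" using that by blast
    then show ?thesis using s_i s_j s_rest by metis
  qed
  have sq: "(c / a / sqrt A)\<^sup>2 = c\<^sup>2 / (a * (a - 1))" "(c / b / sqrt B)\<^sup>2 = c\<^sup>2 / (b * (b - 1))" for c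
  proof -
    have "(c / a / sqrt A)\<^sup>2 = c\<^sup>2 / a\<^sup>2 / A" "(c / b / sqrt B)\<^sup>2 = c\<^sup>2 / b\<^sup>2 / B"
      using AB by (simp_all add: power_divide power_mult_distrib)
    then show "(c / a / sqrt A)\<^sup>2 = c\<^sup>2 / (a * (a - 1))" "(c / b / sqrt B)\<^sup>2 = c\<^sup>2 / (b * (b - 1))"
      using ab by (simp_all add: A_def B_def power2_eq_square)
  qed
  have unit: "(c - 1)\<^sup>2 / (c * (c - 1)) + (c - 1) * (1 / (c * (c - 1))) = 1" if "c \<ge> 2" for c :: real
  proof -
    have "(c - 1)\<^sup>2 / (c * (c - 1)) + (c - 1) * (1 / (c * (c - 1))) = (c - 1) / c + 1 / c"
      using that by (simp add: power2_eq_square)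
    then show ?thesis using that by (simp add: diff_divide_distrib)
  qed
  have n_i: "(\<Sum>x\<in>part t i. (q x)\<^sup>2) = 1"
  proof -
    have "(\<Sum>x\<in>part t i. (q x)\<^sup>2) = ((a - 1) / a / sqrt A)\<^sup>2 + (a - 1) * ((- 1) / a / sqrt A)\<^sup>2"
      by (subst sum_part_one[OF uv(1), of _ "((- 1) / a / sqrt A)\<^sup>2"])
        (auto simp: q_i a_def[symmetric] A_def)
    also have "\<dots> = (a - 1)\<^sup>2 / (a * (a - 1)) + (a - 1) * (1 / (a * (a - 1)))"
      unfolding sq by simp
    also have "\<dots> = 1" using unit ab by simp
    finally show ?thesis .
  qed
  have n_j: "(\<Sum>x\<in>part t j. (q x)\<^sup>2) = 1"
  proof -
    have "(\<Sum>x\<in>part t j. (q x)\<^sup>2) = ((b - 1) / b / sqrt B)\<^sup>2 + (b - 1) * (1 / b / sqrt B)\<^sup>2"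
      by (subst sum_part_one[OF uv(2), of _ "(1 / b / sqrt B)\<^sup>2"])
        (auto simp: q_j b_def[symmetric] B_def)
    also have "\<dots> = (b - 1)\<^sup>2 / (b * (b - 1)) + (b - 1) * (1 / (b * (b - 1)))"
      unfolding sq by simp
    also have "\<dots> = 1" using unit ab by simp
    finally show ?thesis .
  qed
  have n_q: "(\<Sum>x\<in>V. (q x)\<^sup>2) = 2"
    unfolding sum_V_split n_i n_j using q_rest by (simp add: sum.neutral)
  have Q_q: "qform H q = 2 * (sqrt A * sqrt B)"
  proof -
    have "qform H q = - 2 * q u * q v"
      unfolding qform_H sum_V using s by simp
    then show ?thesis using AB by (simp add: q_i q_j real_div_sqrt)
  qed
  have orth: "(\<Sum>x\<in>V. p x * q x) = 0"
    unfolding sum_V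
  proof (rule sum.neutral, rule ballI)
    fix l assume "l \<in> {1..k}"
    have "(\<Sum>x\<in>part t l. p x * q x) = \<gamma> l * (\<Sum>x\<in>part t l. q x)"
      unfolding sum_distrib_left by (rule sum.cong[OF refl]) (simp add: p_def fst_part)
    then show "(\<Sum>x\<in>part t l. p x * q x) = 0" using s[OF \<open>l \<in> {1..k}\<close>] by simp
  qed
  have s_p: "(\<Sum>x\<in>part t l. p x) = real (t l) / (r + real (t l))" for l
    by (subst sum_part_const[of _ _ "\<gamma> l"]) (simp_all add: p_def fst_part \<gamma>_def)
  have n_p: "(\<Sum>x\<in>V. (p x)\<^sup>2) = N"
    unfolding sum_V N_def
  proof (rule sum.cong[OF refl])
    fix l
    show "(\<Sum>x\<in>part t l. (p x)\<^sup>2) = real (t l) / (r + real (t l))\<^sup>2"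
      by (subst sum_part_const[of _ _ "(\<gamma> l)\<^sup>2"])
        (simp_all add: p_def fst_part \<gamma>_def power_divide)
  qed
  have Q_p: "qform H p = r * N - 2 * \<gamma> i * \<gamma> j"
  proof -
    have "(\<Sum>l=1..k. (real (t l) / (r + real (t l)))\<^sup>2) = 1 - r * N"
      unfolding N_def by (rule multipartite_weights_sq[OF _ r]) (use t_pos in auto)
    then show ?thesis unfolding qform_H sum_V s_p r(2) by (simp add: p_def)
  qed
  have \<gamma>: "\<gamma> i > 0" "\<gamma> j > 0" using r(1) by (simp_all add: \<gamma>_def add_pos_nonneg)
  have N_split: "N = a * (\<gamma> i)\<^sup>2 + b * (\<gamma> j)\<^sup>2 + (\<Sum>l\<in>rest. real (t l) / (r + real (t l))\<^sup>2)"
    unfolding N_def sum_classes by (simp add: a_def b_def \<gamma>_def power_divide)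
  have rest_pos: "real (t l) / (r + real (t l))\<^sup>2 > 0" if "l \<in> rest" for l
    using that t_pos[of l] r(1) by (intro divide_pos_pos zero_less_power add_pos_pos) auto
  have rest_nonneg: "(\<Sum>l\<in>rest. real (t l) / (r + real (t l))\<^sup>2) \<ge> 0"
    by (rule sum_nonneg) (use rest_pos in \<open>auto intro: less_imp_le\<close>)
  \<comment> \<open>The Rayleigh quotient of \<open>q\<close> is
    \<open>sqrt A * sqrt B = d / c\<close>, so the goal reduces to comparing
    \<open>2 * c * \<gamma> i * \<gamma> j\<close> with \<open>d * N\<close>.\<close>
  define c d where "c = sqrt (a * b)" and "d = sqrt ((a - 1) * (b - 1))"
  have c: "c > 0" using ab by (simp add: c_def)
  have d: "d \<ge> 1"
  proof -
    have "1 * 1 \<le> (a - 1) * (b - 1)" using ab by (intro mult_mono) auto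
    then show ?thesis by (simp add: d_def)
  qed
  have amgm: "2 * c * \<gamma> i * \<gamma> j \<le> a * (\<gamma> i)\<^sup>2 + b * (\<gamma> j)\<^sup>2"
  proof -
    have "0 \<le> (sqrt a * \<gamma> i - sqrt b * \<gamma> j)\<^sup>2" by simp
    also have "\<dots> = (sqrt a)\<^sup>2 * (\<gamma> i)\<^sup>2 + (sqrt b)\<^sup>2 * (\<gamma> j)\<^sup>2 - 2 * c * \<gamma> i * \<gamma> j"
      by (simp add: c_def real_sqrt_mult power2_diff power_mult_distrib mult_ac)
    finally show ?thesis using ab by simp
  qed
  have N_pos: "N > 0"
    unfolding N_split using ab \<gamma> rest_nonneg by (intro add_pos_nonneg add_pos_pos mult_pos_pos) auto
  \<comment> \<open>Strictness comes from \<open>d > 1\<close> when there are no other parts, and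
    otherwise from their positive share of \<open>N\<close>.\<close>
  have key: "2 * c * \<gamma> i * \<gamma> j < d * N"
  proof (cases "rest = {}")
    case True
    have "1 * 1 < (a - 1) * (b - 1)"
    proof (cases "t i \<ge> 3")
      case True
      then have "1 < a - 1" by (simp add: a_def)
      then show ?thesis using ab by (intro mult_less_le_imp_less) auto
    next
      case False
      then have "1 < b - 1" using big \<open>rest = {}\<close> by (simp add: b_def)
      then show ?thesis using ab by (intro mult_le_less_imp_less) auto
    qed
    then have "1 < d" by (simp add: d_def)
    then have "N < d * N" using N_pos by simp
    then show ?thesis using amgm rest_nonneg by (simp add: N_split)
  next
    case False
    then have "(\<Sum>l\<in>rest. real (t l) / (r + real (t l))\<^sup>2) > 0"
      using rest_pos by (intro sum_pos) auto
    then have "2 * c * \<gamma> i * \<gamma> j < N" using amgm by (simp add: N_split)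
    also have "\<dots> \<le> d * N" using d N_pos by simp
    finally show ?thesis .
  qed
  have "sqrt A * sqrt B = d / c"
    by (simp add: A_def B_def c_def d_def real_sqrt_divide real_sqrt_mult)
  have "2 * \<gamma> i * \<gamma> j / N < d / c" using key c N_pos by (simp add: field_simps)
  moreover have "2 * (qform H p / N + qform H q / 2) \<le> graph_energy H"
    using energy_ge_two[of H p q] orth n_p n_q by simp
  ultimately show ?thesis
    unfolding G Q_p Q_q \<open>sqrt A * sqrt B = d / c\<close> using N_pos by (simp add: diff_divide_distrib)
qed

text \<open>The graph after deletion is a path on four vertices, and explicit test functions give
  energy at least \<open>22/5\<close>, above the energy \<open>4\<close> of the four-cycle.\<close>

lemma energy_increases_K22:
  assumes ti: "t i = 2" and tj: "t j = 2" and rest: "rest = {}"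
  shows "graph_energy H > graph_energy G"
proof -
  have sums: "(\<Sum>l=1..k. f l) = f i + f j" for f :: "nat \<Rightarrow> real"
    unfolding sum_classes rest by simp
  have "graph_energy G = 2 * 2"
    by (rule energy_G) (simp, unfold sums ti tj, simp)
  \<comment> \<open>Along the path from \<open>u\<close> to \<open>v\<close> the test functions are
    \<open>1, 2, 2, 1\<close> and \<open>2, 1, -1, -2\<close>: the two eigenvectors for positive
    eigenvalues with the golden ratio rounded to \<open>2\<close>.\<close>
  define p where "p x = (if x = u \<or> x = v then 1 else 2 :: real)" for x
  define q where "q x = (if x = u then 2 else if x = v then -2 else if fst x = i then -1 else 1 :: real)" for x
  have p: "p u = 1" "p v = 1" by (simp_all add: p_def)
  have q: "q u = 2" "q v = -2" "x \<in> part t i \<Longrightarrow> x \<noteq> u \<Longrightarrow> q x = -1"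
      "x \<in> part t j \<Longrightarrow> x \<noteq> v \<Longrightarrow> q x = 1" for x
    using ij(3) uv_notin by (auto simp: q_def fst_part)
  have pi: "x \<in> part t i \<Longrightarrow> x \<noteq> u \<Longrightarrow> p x = 2" and pj: "x \<in> part t j \<Longrightarrow> x \<noteq> v \<Longrightarrow> p x = 2" for x
    using uv_notin by (auto simp: p_def)
  have "(\<Sum>x\<in>part t i. F x) = F u + c" if "\<And>x. x \<in> part t i \<Longrightarrow> x \<noteq> u \<Longrightarrow> F x = c"
    for F :: "nat \<times> nat \<Rightarrow> real" and c
    using sum_part_one[OF uv(1), of F c] that by (simp add: ti)
  note si = this
  have "(\<Sum>x\<in>part t j. F x) = F v + c" if "\<And>x. x \<in> part t j \<Longrightarrow> x \<noteq> v \<Longrightarrow> F x = c"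
    for F :: "nat \<times> nat \<Rightarrow> real" and c
    using sum_part_one[OF uv(2), of F c] that by (simp add: tj)
  note sj = this
  have P: "(\<Sum>x\<in>part t i. p x) = 3" "(\<Sum>x\<in>part t j. p x) = 3"
    using si[of p 2] sj[of p 2] pi pj p by simp_all
  have Q: "(\<Sum>x\<in>part t i. q x) = 1" "(\<Sum>x\<in>part t j. q x) = -1"
    using si[of q "-1"] sj[of q 1] q by simp_all
  have "(\<Sum>x\<in>V. (p x)\<^sup>2) = 10"
    unfolding sum_V_split rest using si[of "\<lambda>x. (p x)\<^sup>2" 4] sj[of "\<lambda>x. (p x)\<^sup>2" 4] pi pj p by simp
  moreover have "(\<Sum>x\<in>V. (q x)\<^sup>2) = 10"
    unfolding sum_V_split rest using si[of "\<lambda>x. (q x)\<^sup>2" 1] sj[of "\<lambda>x. (q x)\<^sup>2" 1] q by simp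
  moreover have "(\<Sum>x\<in>V. p x * q x) = 0"
    unfolding sum_V_split rest
    using si[of "\<lambda>x. p x * q x" "-2"] sj[of "\<lambda>x. p x * q x" 2] pi pj p q by simp
  moreover have "qform H p = 16" "qform H q = 6"
    unfolding qform_H sum_V sums P Q p q by simp_all
  ultimately have "2 * (16 / 10 + 6 / 10) \<le> graph_energy H"
    using energy_ge_two[of H p q] by simp
  then show ?thesis using \<open>graph_energy G = 2 * 2\<close> by simp
qed

text \<open>The vertices \<open>u\<close> and \<open>w\<close> are adjacent twins, so their
  difference is an eigenfunction for \<open>-1\<close>; the other negative eigenvalue is
  \<open>-\<mu>\<close>. Compensating both by rank-one forms bounds the energy by
  \<open>2 * (1 + \<mu>)\<close>, which is below \<open>2 * r\<close>.\<close>

lemma energy_decreases_one_two: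
  assumes ti: "t i = 1" and tj: "t j = 2" and rest: "rest = {m}"
  shows "graph_energy H < graph_energy G"
proof -
  obtain r where r: "r > 0" "(\<Sum>l=1..k. real (t l) / (r + real (t l))) = 1"
    and G: "graph_energy G = 2 * r" by (rule energy_G_root)
  define n where "n = real (t m)"
  have "m \<in> rest" using rest by (metis singletonI)
  then have n: "n > 0" using t_pos[of m] by (simp add: n_def)
  have sums: "(\<Sum>l=1..k. f l) = f i + f j + f m" for f :: "nat \<Rightarrow> real"
    unfolding sum_classes rest by simp
  have "1 / (r + 1) + 2 / (r + 2) + n / (r + n) = 1"
    using r(2) unfolding sums ti tj n_def by simp
  then obtain \<mu> where \<mu>: "\<mu> > 0" "\<mu> + 1 < r" "\<mu>\<^sup>2 * (\<mu> + 1) = n * (3 * \<mu> + 1)"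
    using one_two_root[OF r(1) n] by metis
  have parts_i: "part t i = {u}" using part_singleton uv ti by auto
  have "card (part t j - {v}) = 1" using uv tj by simp
  then obtain w where w: "part t j - {v} = {w}" by (rule card_1_singletonE)
  have parts_j: "part t j = {v, w}" "v \<noteq> w" using w uv(2) by auto
  have split: "(\<Sum>x\<in>V. F x) = F u + F v + F w + (\<Sum>x\<in>part t m. F x)" for F :: "nat \<times> nat \<Rightarrow> real"
    unfolding sum_V_split rest parts_i using parts_j by simp
  have "fst w = j" by (rule fst_part) (simp add: parts_j)
  then have neq: "u \<noteq> w" "w \<noteq> u" using fst_uv(1) ij(3) by metis+
  have m: "x \<noteq> u \<and> x \<noteq> v \<and> x \<noteq> w" if "x \<in> part t m" for x
    using fst_part[OF that] \<open>fst w = j\<close> \<open>m \<in> rest\<close> by auto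
  define N where "N = 2 / (\<mu> + 1)\<^sup>2 + 1 / \<mu>\<^sup>2 + 1 / n"
  have N: "N > 0" unfolding N_def using \<mu> n by (intro add_pos_pos) auto
  \<comment> \<open>The two eigenfunctions are scaled so that their squared norms are
    \<open>1\<close> and \<open>\<mu>\<close>, the absolute values of their eigenvalues.\<close>
  define p where "p x = (if x = u then 1 / sqrt 2 else if x = w then - (1 / sqrt 2) else 0)" for x
  define q where "q x = sqrt (\<mu> / N) * (if x = u \<or> x = w then 1 / (\<mu> + 1) else if x = v then 1 / \<mu>
    else - (1 / n))" for x
  have pf: "(\<Sum>x\<in>V. p x * f x) = (f u - f w) / sqrt 2" for f
  proof -
    have "(\<Sum>x\<in>part t m. p x * f x) = 0" using m by (intro sum.neutral) (auto simp: p_def)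
    then show ?thesis unfolding split using neq parts_j by (simp add: p_def diff_divide_distrib)
  qed
  have qf: "(\<Sum>x\<in>V. q x * f x)
      = sqrt (\<mu> / N) * ((f u + f w) / (\<mu> + 1) + f v / \<mu> - (\<Sum>x\<in>part t m. f x) / n)" for f
  proof -
    have "(\<Sum>x\<in>part t m. q x * f x) = (\<Sum>x\<in>part t m. - (sqrt (\<mu> / N) / n) * f x)"
      using m by (intro sum.cong refl) (auto simp: q_def)
    then have "(\<Sum>x\<in>part t m. q x * f x) = - (sqrt (\<mu> / N) / n) * (\<Sum>x\<in>part t m. f x)"
      by (simp only: sum_distrib_left)
    then show ?thesis unfolding split using neq parts_j
      by (simp add: q_def ring_distribs add_divide_distrib)
  qed
  have "graph_energy H \<le> 2 * ((\<Sum>x\<in>verts H. (p x)\<^sup>2) + (\<Sum>x\<in>verts H. (q x)\<^sup>2))"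
  proof (rule energy_le_of_qform_ge)
    fix f :: "nat \<times> nat \<Rightarrow> real"
    let ?s = "\<Sum>x\<in>part t m. f x" and ?a = "(f u + f w) / 2"
    have "qform H f = 2 * f u * f w + 2 * ?s * (2 * ?a + f v)"
      unfolding qform_H split sums parts_i using parts_j by (simp add: power2_eq_square algebra_simps)
    \<comment> \<open>This square turns the product \<open>2 * f u * f w\<close> into
      \<open>2 * ?a\<^sup>2\<close>, so that only the symmetric part of \<open>f\<close>
      remains.\<close>
    moreover have "(\<Sum>x\<in>V. p x * f x)\<^sup>2 = 2 * ?a\<^sup>2 - 2 * f u * f w"
      unfolding pf by (simp add: power_divide power2_eq_square field_simps)
    moreover have "(\<Sum>x\<in>V. q x * f x)\<^sup>2 = \<mu> / N * (2 * ?a / (\<mu> + 1) + f v / \<mu> - ?s / n)\<^sup>2"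
    proof -
      have "2 * ?a = f u + f w" by simp
      then show ?thesis unfolding qf using \<mu> N by (simp only: power_mult_distrib) simp
    qed
    ultimately show "0 \<le> qform H f + (\<Sum>x\<in>verts H. p x * f x)\<^sup>2 + (\<Sum>x\<in>verts H. q x * f x)\<^sup>2"
      using one_two_form_nonneg[OF \<mu>(1) n \<mu>(3), of ?a ?s "f v"] unfolding N_def verts_H by linarith
  qed simp
  also have "(\<Sum>x\<in>verts H. (p x)\<^sup>2) = 1"
  proof -
    have "(\<Sum>x\<in>V. p x * p x) = (p u - p w) / sqrt 2" by (rule pf)
    also have "\<dots> = 1" using neq by (simp add: p_def)
    finally show ?thesis by (simp add: power2_eq_square)
  qed
  also have "(\<Sum>x\<in>verts H. (q x)\<^sup>2) = \<mu>"
  proof -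
    have "(\<Sum>x\<in>part t m. q x) = (\<Sum>x\<in>part t m. - (sqrt (\<mu> / N) / n))"
      using m by (intro sum.cong refl) (auto simp: q_def)
    then have "(\<Sum>x\<in>part t m. q x) / n = - (sqrt (\<mu> / N) / n)" using n by (simp add: n_def)
    then have "(\<Sum>x\<in>V. q x * q x)
        = sqrt (\<mu> / N) * ((q u + q w) / (\<mu> + 1) + q v / \<mu> + sqrt (\<mu> / N) / n)"
      unfolding qf by simp
    also have "\<dots> = sqrt (\<mu> / N) * (sqrt (\<mu> / N) * N)"
      using neq parts_j by (simp add: q_def N_def power2_eq_square field_simps)
    also have "\<dots> = \<mu>" using \<mu> N by (simp add: mult.assoc[symmetric])
    finally show ?thesis by (simp add: power2_eq_square)
  qed
  finally show ?thesis using \<mu>(2) G by simp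
qed

section \<open>The secular function for an edge at a singleton part\<close>

definition rest_sum :: "real \<Rightarrow> real" where
  "rest_sum x = (\<Sum>l\<in>rest. real (t l) / (x + real (t l)))"

text \<open>For \<open>t i = 1\<close> this is the secular contribution of two parts of sizes
  \<open>1\<close> and \<open>t j - 1\<close>: the vertex \<open>u\<close>, and the
  \<open>j\<close>-part without \<open>v\<close>.\<close>

definition pair_sum :: "real \<Rightarrow> real" where
  "pair_sum x = 1 / (x + 1) + (real (t j) - 1) / (x + (real (t j) - 1))"

text \<open>For \<open>t i = 1\<close> the positive roots of this function are eigenvalues of \<open>H\<close>.\<close>

definition secular :: "real \<Rightarrow> real" where
  "secular x = x * (1 - pair_sum x) - rest_sum x * (x + 1 - pair_sum x)"

lemma rest_t_pos: "l \<in> rest \<Longrightarrow> real (t l) \<ge> 1"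
  using t_pos[of l] by (simp add: Suc_le_eq)

text \<open>An eigenfunction constant on \<open>u\<close>, on \<open>v\<close>, on the rest of the
  \<open>j\<close>-part and on each other part is determined by the equations at the vertices once
  its total minus \<open>y v\<close> is normalised to \<open>x\<close>. The remaining condition,
  that the values really add up to the presumed total \<open>D\<close>, is
  \<open>secular x = 0\<close>.\<close>

lemma secular_root_eigenfunction:
  assumes ti: "t i = 1" and tj: "t j \<ge> 2" and x: "x > 0" and root: "secular x = 0"
  shows "\<exists>y. (\<forall>z\<in>V. (\<Sum>w\<in>V. adj H z w * y w) = x * y z) \<and> y u \<noteq> 0"
proof -
  define n where "n = real (t j) - 1"
  have n: "n \<ge> 1" using tj by (simp add: n_def)
  define c where "c = pair_sum x"
  have c: "c = 1 / (x + 1) + n / (x + n)" by (simp add: c_def pair_sum_def n_def)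
  define D where "D = x + 1 - c"
  define y where "y z = (if z = u then x / (x + 1) else if z = v then 1 - c
    else if fst z = j then x / (x + n) else D / (x + real (t (fst z))))" for z
  have part_i: "part t i = {u}" using part_singleton uv ti by auto
  have y_uv: "y u = x / (x + 1)" "y v = 1 - c" by (simp_all add: y_def)
  have y_j: "y z = x / (x + n)" if "z \<in> part t j" "z \<noteq> v" for z
    using that uv_notin by (auto simp: y_def fst_part)
  have y_rest: "y z = D / (x + real (t l))" if "z \<in> part t l" "l \<in> rest" for z l
  proof -
    have "fst z = l" using that(1) by (rule fst_part)
    moreover have "z \<noteq> u" "z \<noteq> v" using \<open>fst z = l\<close> that(2) by auto
    ultimately show ?thesis using that(2) by (simp add: y_def)
  qed
  have s_i: "(\<Sum>z\<in>part t i. y z) = x / (x + 1)" by (simp add: part_i y_uv)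
  have s_j: "(\<Sum>z\<in>part t j. y z) = 1 - c + n * (x / (x + n))"
    using sum_part_one[OF uv(2) y_j] by (simp add: y_uv n_def)
  have s_l: "(\<Sum>z\<in>part t l. y z) = real (t l) * (D / (x + real (t l)))" if "l \<in> rest" for l
    using y_rest[OF _ that] by (rule sum_part_const)
  have f1: "x / (x + 1) = 1 - 1 / (x + 1)" "x / (x + n) = 1 - n / (x + n)"
    using x n by (simp_all add: field_simps)
  have f2: "n * (x / (x + n)) = x * (n / (x + n))" by simp
  have "x / (x + 1) + n * (x / (x + n)) = x * c" unfolding f2 c by (simp add: distrib_left)
  then have S_ij: "x / (x + 1) + (1 - c + n * (x / (x + n))) = x * c + 1 - c" by simp
  have "(\<Sum>l\<in>rest. \<Sum>z\<in>part t l. y z) = (\<Sum>l\<in>rest. D * (real (t l) / (x + real (t l))))"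
    by (rule sum.cong[OF refl]) (simp add: s_l)
  then have S_rest: "(\<Sum>l\<in>rest. \<Sum>z\<in>part t l. y z) = D * rest_sum x"
    by (simp only: rest_sum_def sum_distrib_left)
  have "x * (1 - c) = rest_sum x * D" using root by (simp add: secular_def c_def D_def)
  then have S: "(\<Sum>z\<in>V. y z) = D"
    unfolding sum_V_split s_i s_j S_rest S_ij by (simp add: D_def algebra_simps)
  have "(\<Sum>w\<in>V. adj H z w * y w) = x * y z" if z: "z \<in> V" for z
  proof -
    have fz: "fst z \<in> {1..k}" "z \<in> part t (fst z)" using z by (simp_all add: verts_complete_multipartite)
    consider "z = u" | "z = v" | "z \<noteq> u" "z \<noteq> v" "fst z = j" | "fst z \<in> rest"
    proof -
      have "z = u" if "fst z = i" using that fz(2) part_i by auto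
      then show ?thesis using that fz(1) by blast
    qed
    then show ?thesis
    proof cases
      case 1
      then show ?thesis unfolding adj_H_sum[OF z] S using x
        by (simp add: s_i y_uv D_def) (simp add: field_simps)
    next
      case 2
      then show ?thesis unfolding adj_H_sum[OF z] S
        using \<open>x / (x + 1) + n * (x / (x + n)) = x * c\<close>
        by (simp add: s_j y_uv D_def algebra_simps)
    next
      case 3
      then have "y z = x / (x + n)" using y_j fz(2) by metis
      moreover have "D - (1 - c + n * (x / (x + n))) = x * (x / (x + n))"
        unfolding D_def f2 unfolding f1(2) by (simp add: algebra_simps)
      ultimately show ?thesis unfolding adj_H_sum[OF z] S using 3 by (simp add: s_j)
    next
      case 4
      then have "z \<noteq> u" "z \<noteq> v" by auto
      have "D - real (t (fst z)) * (D / (x + real (t (fst z)))) = x * (D / (x + real (t (fst z))))"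
        using x by (simp add: field_simps)
      then show ?thesis
        unfolding adj_H_sum[OF z] S s_l[OF 4] y_rest[OF fz(2) 4]
        using \<open>z \<noteq> u\<close> \<open>z \<noteq> v\<close> by simp
    qed
  qed
  moreover have "y u \<noteq> 0" using x by (simp add: y_uv)
  ultimately show ?thesis by blast
qed

lemma secular_continuous: "t j \<ge> 2 \<Longrightarrow> a > 0 \<Longrightarrow> continuous_on {a..b} secular"
  unfolding secular_def pair_sum_def rest_sum_def
  by (intro continuous_intros) (auto simp: add_pos_nonneg pos_add_strict)

text \<open>The first term of \<open>secular\<close> is at least \<open>x - (1 + n)\<close>, while
  the second stays below twice the total size of the remaining parts. This supplies a right end
  point for locating the larger root.\<close>

lemma secular_eventually_pos:
  assumes tj: "t j \<ge> 2"
  obtains x where "x \<ge> a" "secular x > 0"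
proof -
  define n where "n = real (t j) - 1"
  have n: "n \<ge> 1" using tj by (simp add: n_def)
  define T where "T = (\<Sum>l\<in>rest. real (t l))"
  have T: "T \<ge> 0" by (simp add: T_def sum_nonneg)
  define x where "x = \<bar>a\<bar> + n + 2 * T + 2"
  have x: "x \<ge> 1" "x \<ge> a" using n T by (simp_all add: x_def)
  define c where "c = pair_sum x"
  have c: "c = 1 / (x + 1) + n / (x + n)" by (simp add: c_def pair_sum_def n_def)
  have c0: "c \<ge> 0" unfolding c using x n by (intro add_nonneg_nonneg divide_nonneg_nonneg) auto
  have xc: "x * c \<le> 1 + n"
  proof -
    have "x * c = x / (x + 1) + n * (x / (x + n))" unfolding c by (simp add: distrib_left)
    also have "\<dots> \<le> 1 + n * 1"
      using x n by (intro add_mono mult_left_mono) auto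
    finally show ?thesis by simp
  qed
  have "rest_sum x \<le> (\<Sum>l\<in>rest. real (t l) / x)"
    unfolding rest_sum_def using x by (intro sum_mono divide_left_mono mult_pos_pos add_pos_nonneg) auto
  then have f: "rest_sum x \<le> T / x" by (simp add: T_def sum_divide_distrib)
  have f0: "rest_sum x \<ge> 0"
    unfolding rest_sum_def using x by (intro sum_nonneg divide_nonneg_nonneg) auto
  have "rest_sum x * (x + 1 - c) \<le> rest_sum x * (x + 1)" using c0 f0 by (intro mult_left_mono) auto
  also have "\<dots> \<le> T / x * (2 * x)" using x f T by (intro mult_mono) auto
  also have "\<dots> = 2 * T" using x by simp
  finally have "secular x \<ge> x - (1 + n) - 2 * T"
    using xc by (simp add: secular_def c_def[symmetric] right_diff_distrib)
  then have "secular x > 0" by (simp add: x_def)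
  with x(2) show thesis by (rule that)
qed

text \<open>The signs at \<open>b\<close>, at \<open>r - b\<close> and far to the right separate two
  roots: the smaller is at least \<open>b\<close> and the larger exceeds \<open>r - b\<close>, so
  their sum exceeds \<open>r\<close>. Both are eigenvalues with nonzero eigenfunctions.\<close>

lemma energy_ge_of_secular:
  assumes ti: "t i = 1" and tj: "t j \<ge> 2" and b: "b > 0" "b < r - b"
    and sec: "secular b \<ge> 0" "secular (r - b) < 0"
  shows "2 * r < graph_energy H"
proof -
  obtain x2 where x2: "b \<le> x2" "x2 \<le> r - b" "secular x2 = 0"
    using IVT2'[of secular "r - b" 0 b] sec b secular_continuous[OF tj b(1), of "r - b"]
    by (auto intro: less_imp_le)
  obtain M where M: "M \<ge> r - b" "secular M > 0" using secular_eventually_pos[OF tj] .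
  obtain x1 where x1: "r - b \<le> x1" "x1 \<le> M" "secular x1 = 0"
    using IVT'[of secular "r - b" 0 M] sec M secular_continuous[OF tj, of "r - b" M] b
    by (auto intro: less_imp_le)
  have ne: "x1 \<noteq> r - b" "x2 \<noteq> r - b" using x1 x2 sec by auto
  obtain y1 where y1: "\<And>z. z \<in> V \<Longrightarrow> (\<Sum>w\<in>V. adj H z w * y1 w) = x1 * y1 z" "y1 u \<noteq> 0"
    using secular_root_eigenfunction[OF ti tj _ x1(3)] x1(1) b by auto
  obtain y2 where y2: "\<And>z. z \<in> V \<Longrightarrow> (\<Sum>w\<in>V. adj H z w * y2 w) = x2 * y2 z" "y2 u \<noteq> 0"
    using secular_root_eigenfunction[OF ti tj _ x2(3)] x2(1) b by auto
  have "2 * (x1 + x2) \<le> graph_energy H"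
  proof (rule energy_ge_eigenvalues[of H x1 x2 y1 y2])
    show "x1 \<noteq> x2" using x1 x2 ne by linarith
    show "\<exists>x\<in>verts H. y1 x \<noteq> 0" "\<exists>x\<in>verts H. y2 x \<noteq> 0"
      using y1(2) y2(2) uv_V(1) verts_H by blast+
  qed (use y1 y2 in auto)
  moreover have "r < x1 + x2" using x1 x2 ne by linarith
  then have "2 * r < 2 * (x1 + x2)" by simp
  ultimately show ?thesis by simp
qed

lemma secular_polynomial:
  assumes tj: "t j \<ge> 2" and x: "x > 0"
  defines "m \<equiv> real (t j)"
  shows "secular x * ((x + 1) * (x + (m - 1))) = x * (x\<^sup>2 - (m - 1))
    - rest_sum x * (x^3 + (m + 1) * x\<^sup>2 + (m - 1) * x - (m - 1))"
proof -
  have m: "m \<ge> 2" using tj by (simp add: m_def)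
  define E where "E = (x + 1) * (x + (m - 1))"
  have "p / a + q / b = (p * b + q * a) / (a * b)" if "a > 0" "b > 0" for a b p q :: real
    using that by (simp add: field_simps)
  then have "pair_sum x = ((x + (m - 1)) + (m - 1) * (x + 1)) / E"
    unfolding pair_sum_def m_def[symmetric] E_def using x m by simp
  then have pair: "pair_sum x * E = (x + (m - 1)) + (m - 1) * (x + 1)"
    using x m by (simp add: E_def)
  have "secular x * E = x * (E - pair_sum x * E) - rest_sum x * ((x + 1) * E - pair_sum x * E)"
    by (simp add: secular_def algebra_simps)
  then show ?thesis unfolding pair unfolding E_def
    by (simp add: power2_eq_square power3_eq_cube algebra_simps)
qed

section \<open>Signs of the secular function at \<open>1/3\<close> and
  \<open>r - 1/3\<close>\<close>

text \<open>Merging the remaining parts into one part of real size with the same total weight at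
  \<open>r\<close> can only lower the secular contribution at \<open>x\<close>, by subadditivity of
  \<open>transfer\<close>.\<close>

lemma rest_sum_ge_transfer:
  assumes "x > 0" "x \<le> r"
  shows "transfer r x (rest_sum r) \<le> rest_sum x"
proof -
  have "transfer r x (rest_sum r) \<le> (\<Sum>l\<in>rest. transfer r x (real (t l) / (r + real (t l))))"
    unfolding rest_sum_def using assms by (intro transfer_sum_le) auto
  also have "\<dots> = rest_sum x"
    unfolding rest_sum_def
    by (rule sum.cong[OF refl], rule transfer_weight) (use assms rest_t_pos in fastforce)+
  finally show ?thesis .
qed

lemma weight_ge: "l \<in> rest \<Longrightarrow> r > 0 \<Longrightarrow> 1 / (r + 1) \<le> real (t l) / (r + real (t l))"
  using rest_t_pos[of l] by (simp add: field_simps)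

text \<open>With at least two remaining parts a sharper comparison keeps a singleton: all but one of
  them are merged, then weight is shifted until one of the two has only the weight
  \<open>1 / (r + 1)\<close> of a singleton.\<close>

lemma rest_sum_ge_transfer_two:
  assumes x: "x > 0" "x \<le> r" and two: "card rest \<ge> 2"
  shows "1 / (x + 1) + transfer r x (rest_sum r - 1 / (r + 1)) \<le> rest_sum x"
    and "2 / (r + 1) \<le> rest_sum r"
proof -
  have r: "r > 0" using x by simp
  let ?w = "\<lambda>l. real (t l) / (r + real (t l))"
  have "rest \<noteq> {}" using two by (metis card.empty not_numeral_le_zero)
  then obtain l0 where l0: "l0 \<in> rest" by blast
  have "card (rest - {l0}) \<ge> 1" using two l0 by simp
  then obtain l1 where l1: "l1 \<in> rest - {l0}" by (metis card.empty ex_in_conv not_one_le_zero)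
  define b where "b = (\<Sum>l\<in>rest - {l0}. ?w l)"
  have W: "rest_sum r = ?w l0 + b"
    unfolding rest_sum_def b_def using l0 by (intro sum.remove) auto
  have "?w l1 \<le> b"
    unfolding b_def by (rule member_le_sum) (use l1 r in auto)
  then have ge: "1 / (r + 1) \<le> ?w l0" "1 / (r + 1) \<le> b"
    using weight_ge[of l0 r] weight_ge[of l1 r] l0 l1 r by auto
  then show "2 / (r + 1) \<le> rest_sum r" unfolding W by simp
  have "1 / (x + 1) + transfer r x (rest_sum r - 1 / (r + 1))
      = transfer r x (1 / (r + 1)) + transfer r x (?w l0 + b - 1 / (r + 1))"
    using transfer_weight[of r x 1] x r by (simp add: W)
  also have "\<dots> \<le> transfer r x (?w l0) + transfer r x b"
    using x r ge by (intro transfer_spread) auto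
  also have "\<dots> \<le> transfer r x (?w l0) + (\<Sum>l\<in>rest - {l0}. transfer r x (?w l))"
    unfolding b_def using x r by (intro add_left_mono transfer_sum_le) auto
  also have "\<dots> = (\<Sum>l\<in>rest. transfer r x (?w l))"
    using l0 by (intro sum.remove[symmetric]) auto
  also have "\<dots> = rest_sum x"
    unfolding rest_sum_def
    by (rule sum.cong[OF refl], rule transfer_weight) (use x r rest_t_pos in fastforce)+
  finally show "1 / (x + 1) + transfer r x (rest_sum r - 1 / (r + 1)) \<le> rest_sum x" .
qed

text \<open>At \<open>1/3\<close> each remaining part contributes at least \<open>3/4\<close>. After
  clearing denominators, one such part suffices for \<open>m \<ge> 3\<close>, whereas
  \<open>m = 2\<close> calls for two.\<close>

lemma secular_third_nonneg:
  assumes tj: "t j \<ge> 2" and rest: "rest \<noteq> {}" and big: "t j \<ge> 3 \<or> card rest \<ge> 2"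
  shows "secular (1/3) \<ge> 0"
proof -
  define m where "m = real (t j)"
  have m: "m \<ge> 2" using tj by (simp add: m_def)
  have "(\<Sum>l\<in>rest. 3/4) \<le> rest_sum (1/3)"
    unfolding rest_sum_def
  proof (rule sum_mono)
    fix l assume "l \<in> rest"
    from rest_t_pos[OF this] show "3/4 \<le> real (t l) / (1/3 + real (t l))" by (simp add: field_simps)
  qed
  then have f: "rest_sum (1/3) \<ge> 3/4 * real (card rest)" by simp
  have "card rest \<ge> 1" using rest by (simp add: Suc_le_eq card_gt_0_iff)
  have "(9 * m - 10) \<le> rest_sum (1/3) * (15 * m - 22)"
  proof (cases "t j \<ge> 3")
    case True
    then have "m \<ge> 3" by (simp add: m_def)
    moreover have "3/4 \<le> rest_sum (1/3)" using f \<open>card rest \<ge> 1\<close> by linarith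
    then have "3/4 * (15 * m - 22) \<le> rest_sum (1/3) * (15 * m - 22)"
      using m by (intro mult_right_mono) auto
    moreover have "9 * m - 10 \<le> 3/4 * (15 * m - 22)" using \<open>m \<ge> 3\<close> by simp
    ultimately show ?thesis by (meson order_trans)
  next
    case False
    then have "m = 2" "card rest \<ge> 2" using tj big by (auto simp: m_def)
    then show ?thesis using f by simp
  qed
  moreover have "secular (1/3) * ((1/3 + 1) * (1/3 + (m - 1)))
      = (rest_sum (1/3) * (15 * m - 22) - (9 * m - 10)) / 27"
  proof -
    have "(1/3)^3 + (m + 1) * (1/3)\<^sup>2 + (m - 1) * (1/3) - (m - 1) = - ((15 * m - 22) / 27)"
      "1/3 * ((1/3)\<^sup>2 - (m - 1)) = (10 - 9 * m) / 27"
      by (simp_all add: power2_eq_square power3_eq_cube field_simps)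
    then have "secular (1/3) * ((1/3 + 1) * (1/3 + (m - 1)))
        = (10 - 9 * m) / 27 - rest_sum (1/3) * (- ((15 * m - 22) / 27))"
      using secular_polynomial[OF tj, of "1/3", folded m_def] by simp
    also have "\<dots> = (rest_sum (1/3) * (15 * m - 22) - (9 * m - 10)) / 27" by (simp add: field_simps)
    finally show ?thesis .
  qed
  ultimately have "secular (1/3) * ((1/3 + 1) * (1/3 + (m - 1))) \<ge> 0" by simp
  then show ?thesis using m by (simp add: zero_le_mult_iff)
qed

text \<open>The secular equation of the original graph determines \<open>rest_sum r\<close> in terms
  of \<open>r\<close> and \<open>m\<close>. The concavity bounds carry this to a lower bound for
  \<open>rest_sum x\<close> at \<open>x = r - 1/3\<close>, and there \<open>rest_sum\<close> enters
  \<open>secular\<close> with a negative coefficient.\<close>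

lemma energy_increases_one_many:
  assumes ti: "t i = 1" and tj: "t j \<ge> 2" and rest: "rest \<noteq> {}" and big: "t j \<ge> 3 \<or> card rest \<ge> 2"
  shows "graph_energy H > graph_energy G"
proof -
  obtain r where r: "r > 0" "(\<Sum>l=1..k. real (t l) / (r + real (t l))) = 1"
    and G: "graph_energy G = 2 * r" by (rule energy_G_root)
  define m where "m = real (t j)"
  have m: "m \<ge> 2" using tj by (simp add: m_def)
  have "p / a + q / b = (p * b + q * a) / (a * b)" if "a > 0" "b > 0" for a b p q :: real
    using that by (simp add: field_simps)
  then have add: "1 / (r + 1) + m / (r + m) = ((r + m) + m * (r + 1)) / ((r + 1) * (r + m))"
    using r m by simp
  have "rest_sum r = 1 - (1 / (r + 1) + m / (r + m))"
    using r(2) unfolding sum_classes rest_sum_def ti m_def by simp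
  also have "\<dots> = ((r + 1) * (r + m) - ((r + m) + m * (r + 1))) / ((r + 1) * (r + m))"
    unfolding add using r m by (simp add: diff_divide_distrib)
  also have "(r + 1) * (r + m) - ((r + m) + m * (r + 1)) = r\<^sup>2 - m"
    by (simp add: power2_eq_square algebra_simps)
  finally have W: "rest_sum r = (r\<^sup>2 - m) / ((r + 1) * (r + m))" .
  obtain l where l: "l \<in> rest" using rest by blast
  have "1 / (r + 1) \<le> real (t l) / (r + real (t l))" by (rule weight_ge[OF l r(1)])
  also have "\<dots> \<le> rest_sum r"
    unfolding rest_sum_def by (rule member_le_sum) (use l r(1) in auto)
  finally have weight: "(r + m) / ((r + 1) * (r + m)) \<le> (r\<^sup>2 - m) / ((r + 1) * (r + m))"
    using W r m by simp
  have cancel: "p \<le> q" if "p / c \<le> q / c" "c > 0" for p q c :: real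
    using that by (simp add: divide_le_cancel)
  \<comment> \<open>At least one further part exists and weighs no less than a singleton; this
    bounds \<open>r\<close> from below.\<close>
  have r2: "r + m \<le> r\<^sup>2 - m" by (rule cancel[OF weight]) (use r m in simp)
  define x where "x = r - 1/3"
  have sec: "secular x < 0 \<and> r \<ge> 3"
  proof (cases "t j \<ge> 3")
    case True
    then have m3: "m \<ge> 3" by (simp add: m_def)
    have r3: "r \<ge> 3"
    proof (rule ccontr)
      assume "\<not> r \<ge> 3"
      then have "0 < (3 - r) * (r + 2)" using r(1) by (intro mult_pos_pos) auto
      then show False using r2 m3 by (simp add: power2_eq_square algebra_simps)
    qed
    have x: "x > 0" "x \<le> r" "x \<ge> 2" using r3 by (simp_all add: x_def)
    let ?X = "r * (r\<^sup>2 - m)" and ?p = "x^3 + (m + 1) * x\<^sup>2 + (m - 1) * x - (m - 1)"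
    let ?Y = "?X + x * ((m + 1) * r + 2 * m)"
    have Y: "?Y > 0" using r m r2 x by (intro add_nonneg_pos mult_nonneg_nonneg mult_pos_pos add_pos_pos) auto
    \<comment> \<open>Inserting \<open>W\<close> and clearing its denominator produces exactly the
      fraction treated in \<open>secular_ineq_large_part\<close>.\<close>
    have "transfer r x (rest_sum r) = ?X / ?Y"
    proof -
      define E where "E = (r + 1) * (r + m)"
      have E: "E > 0" using r m by (simp add: E_def)
      have "x + (r - x) * ((r\<^sup>2 - m) / E) = (x * E + (r - x) * (r\<^sup>2 - m)) / E"
        using E by (simp add: add_divide_distrib)
      also have "x * E + (r - x) * (r\<^sup>2 - m) = ?Y"
        by (simp add: E_def power2_eq_square algebra_simps)
      finally show ?thesis unfolding W E_def[symmetric] transfer_def using E by simp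
    qed
    then have f: "?X / ?Y \<le> rest_sum x" using rest_sum_ge_transfer[OF x(1,2)] by simp
    have "(m - 1) * x \<ge> (m - 1) * 1" using x m by (intro mult_left_mono) auto
    moreover have "x^3 > 0" "(m + 1) * x\<^sup>2 > 0" using x m by simp_all
    moreover have "a + b + c - d > 0" if "d * 1 \<le> c" "a > 0" "b > 0" for a b c d :: real
      using that by simp
    ultimately have p: "?p > 0" by blast
    have "x * (x\<^sup>2 - (m - 1)) < ?X * ?p / ?Y"
      using secular_ineq_large_part[OF m3 r3] Y unfolding x_def by (simp add: pos_less_divide_eq)
    also have "\<dots> \<le> rest_sum x * ?p" using mult_right_mono[OF f, of ?p] p by simp
    finally have "secular x * ((x + 1) * (x + (m - 1))) < 0"
      using secular_polynomial[OF tj x(1)] by (simp add: m_def[symmetric])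
    then show ?thesis using x m r3 by (simp add: mult_less_0_iff)
  next
    case False
    then have m2: "m = 2" and two: "card rest \<ge> 2" using tj big by (auto simp: m_def)
    have "2 / (r + 1) \<le> (r\<^sup>2 - 2) / ((r + 1) * (r + 2))"
      using rest_sum_ge_transfer_two(2)[OF r(1) order_refl two] W m2 by simp
    moreover have "2 / (r + 1) = 2 * (r + 2) / ((r + 1) * (r + 2))"
      by (rule mult_divide_mult_cancel_right[symmetric]) (use r(1) in simp)
    ultimately have "2 * (r + 2) / ((r + 1) * (r + 2)) \<le> (r\<^sup>2 - 2) / ((r + 1) * (r + 2))"
      by (simp only:)
    then have r2': "2 * (r + 2) \<le> r\<^sup>2 - 2" by (rule cancel) (use r(1) in simp)
    \<comment> \<open>The bound \<open>r2'\<close> puts \<open>r\<close> above the positive root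
      \<open>1 + sqrt 7\<close> of \<open>r\<^sup>2 - 2 * r - 6\<close>; \<open>18/5\<close> is a
      rational number just below it.\<close>
    have r3: "r \<ge> 18/5"
    proof (rule ccontr)
      assume "\<not> r \<ge> 18/5"
      then have "0 < (18/5 - r) * (r + 8/5)" using r(1) by (intro mult_pos_pos) auto
      then show False using r2' by (simp add: power2_eq_square algebra_simps)
    qed
    have x: "x > 0" "x \<le> r" "x \<ge> 2" using r3 by (simp_all add: x_def)
    let ?X = "r * (r\<^sup>2 - r - 4)" and ?q = "x\<^sup>2 + 2 * x - 1"
    let ?D = "?X + x * (4 * r + 6)"
    have D: "?D > 0" using r r2' r3 x by (intro add_nonneg_pos mult_nonneg_nonneg mult_pos_pos) auto
    have "transfer r x (rest_sum r - 1 / (r + 1)) = ?X / ?D"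
    proof -
      define E where "E = (r + 1) * (r + 2)"
      have E: "E > 0" using r by (simp add: E_def)
      have "1 / (r + 1) = (r + 2) / E" using r(1) by (simp add: E_def)
      then have W': "rest_sum r - 1 / (r + 1) = (r\<^sup>2 - r - 4) / E"
        unfolding W m2 E_def[symmetric] by (simp add: diff_divide_distrib[symmetric])
      have "x + (r - x) * ((r\<^sup>2 - r - 4) / E) = (x * E + (r - x) * (r\<^sup>2 - r - 4)) / E"
        using E by (simp add: add_divide_distrib)
      also have "x * E + (r - x) * (r\<^sup>2 - r - 4) = ?D"
        by (simp add: E_def power2_eq_square algebra_simps)
      finally show ?thesis unfolding W' transfer_def using E by simp
    qed
    then have f: "1 / (x + 1) + ?X / ?D \<le> rest_sum x"
      using rest_sum_ge_transfer_two(1)[OF x(1,2) two] by simp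
    have q: "?q > 0" using x(3) zero_le_power2[of x] by linarith
    have "p / a + q / b = (b + a * q) / (a * b)" if "a > 0" "b > 0" "p = 1" for a b p q :: real
      using that by (simp add: field_simps)
    then have "1 / (x + 1) + ?X / ?D = (?D + (x + 1) * ?X) / ((x + 1) * ?D)"
      using x D by simp
    then have f': "(?D + (x + 1) * ?X) / ((x + 1) * ?D) \<le> rest_sum x" using f by simp
    have "x * (x - 1) * ((x + 1) * ?D) < (?D + (x + 1) * ?X) * ?q"
      using secular_ineq_four_parts[OF r3] by (simp add: x_def[symmetric] mult.assoc)
    then have "x * (x - 1) < (?D + (x + 1) * ?X) * ?q / ((x + 1) * ?D)"
      using x D by (subst pos_less_divide_eq) auto
    also have "\<dots> \<le> rest_sum x * ?q" using mult_right_mono[OF f', of ?q] q by simp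
    finally have lt: "x * (x - 1) - rest_sum x * ?q < 0" by simp
    \<comment> \<open>For \<open>m = 2\<close> both polynomials in the cleared form share the factor
      \<open>x + 1\<close>, since \<open>x^3 + 3 * x\<^sup>2 + x - 1 = (x + 1) * (x\<^sup>2 + 2 * x
      - 1)\<close>.\<close>
    have "secular x * ((x + 1) * (x + 1)) = (x + 1) * (x * (x - 1) - rest_sum x * ?q)"
      using secular_polynomial[OF tj x(1)] m2
      by (simp add: m_def[symmetric] power2_eq_square power3_eq_cube algebra_simps)
    also have "\<dots> < 0" using lt x by (simp add: mult_less_0_iff)
    finally show ?thesis using x r3 by (simp add: mult_less_0_iff)
  qed
  have "2 * r < graph_energy H"
    using energy_ge_of_secular[OF ti tj, of "1/3" r] secular_third_nonneg[OF tj rest big] sec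
    by (simp add: x_def)
  then show ?thesis by (simp add: G)
qed

end

section \<open>Combination of the cases\<close>

lemma multipartite_edge_swap: "multipartite_edge k t i j u v \<Longrightarrow> multipartite_edge k t j i v u"
  unfolding multipartite_edge_def by auto

text \<open>With the smaller part listed first, the three ranges of \<open>k\<close> are covered by
  one condition describing when the energy drops.\<close>

lemma energy_change_ordered:
  assumes E: "multipartite_edge k t i j u v" and le: "t i \<le> t j" and k: "k \<ge> 2"
  shows "if t i = 1 \<and> (t j = 1 \<or> k = 2 \<or> k = 3 \<and> t j = 2)
    then graph_energy (delete_edge (complete_multipartite k t) {u, v}) < graph_energy (complete_multipartite k t)
    else graph_energy (delete_edge (complete_multipartite k t) {u, v}) > graph_energy (complete_multipartite k t)"
proof -
  interpret multipartite_edge k t i j u v by (rule E)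
  have card_rest: "card rest = k - 2"
    using ij by (simp add: card_Diff_subset)
  have pos: "t i \<ge> 1" "t j \<ge> 1" using t_pos[OF ij(1)] t_pos[OF ij(2)] by auto
  have rest: "rest = {} \<longleftrightarrow> k = 2" using card_rest k by (metis card_0_eq diff_is_0_eq finite_Diff finite_atLeastAtMost le_antisym)
  show ?thesis
  proof (cases "t i = 1")
    case i1: True
    show ?thesis
    proof (cases "t j = 1")
      case True
      then show ?thesis using i1 energy_decreases_one_one by simp
    next
      case False
      then have j2: "t j \<ge> 2" using pos by simp
      \<comment> \<open>There are \<open>k - 2\<close> remaining parts, so \<open>k \<ge> 4\<close>
        already provides two of them, and \<open>k = 3\<close> outside the second case forces
        \<open>t j \<ge> 3\<close>.\<close>
      consider "k = 2" | "k = 3" "t j = 2" | "k \<ge> 3" "t j \<ge> 3 \<or> card rest \<ge> 2"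
        using k j2 card_rest by linarith
      then show ?thesis
      proof cases
        case 1
        then show ?thesis using i1 j2 energy_decreases_star by simp
      next
        case 2
        then have "card rest = 1" using card_rest by simp
        then obtain m where "rest = {m}" by (rule card_1_singletonE)
        then show ?thesis using 2 i1 energy_decreases_one_two by simp
      next
        case 3
        then have "graph_energy H > graph_energy G"
          using rest by (intro energy_increases_one_many[OF i1 j2]) simp_all
        moreover have "\<not> (t i = 1 \<and> (t j = 1 \<or> k = 2 \<or> k = 3 \<and> t j = 2))"
          using 3 j2 card_rest by auto
        ultimately show ?thesis by (simp only: if_False)
      qed
    qed
  next
    case False
    then have ge: "t i \<ge> 2" "t j \<ge> 2" using pos le by simp_all
    have "graph_energy H > graph_energy G"
    proof (cases "rest = {} \<and> t i = 2 \<and> t j = 2")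
      case True
      then show ?thesis by (intro energy_increases_K22) simp_all
    next
      case False
      then show ?thesis using ge by (intro energy_increases_both_ge_2) auto
    qed
    then show ?thesis using False by simp
  qed
qed

theorem theorem1:
  fixes k i j :: nat and t :: "nat \<Rightarrow> nat" and u v :: "nat \<times> nat" and e :: "(nat \<times> nat) set"
  defines "G \<equiv> complete_multipartite k t"
  assumes "k \<ge> 2"
    and "\<And>l. l \<in> {1..k} \<Longrightarrow> t l > 0"
    and "i \<in> {1..k}" and "j \<in> {1..k}" and "i \<noteq> j"
    and "e \<in> edges G"
    and "e = {u, v}" and "u \<in> part t i" and "v \<in> part t j"
  shows "(k \<ge> 4 \<longrightarrow>
           (if t i = 1 \<and> t j = 1
            then graph_energy (delete_edge G e) < graph_energy G
            else graph_energy (delete_edge G e) > graph_energy G)) \<and>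
         (k = 3 \<longrightarrow>
           (if t i + t j \<le> 3
            then graph_energy (delete_edge G e) < graph_energy G
            else graph_energy (delete_edge G e) > graph_energy G)) \<and>
         (k = 2 \<longrightarrow>
           (if min (t i) (t j) = 1
            then graph_energy (delete_edge G e) < graph_energy G
            else graph_energy (delete_edge G e) > graph_energy G))"
proof -
  have E: "multipartite_edge k t i j u v" using assms by unfold_locales auto
  have pos: "t i \<ge> 1" "t j \<ge> 1" using assms(3)[OF assms(4)] assms(3)[OF assms(5)] by auto
  show ?thesis
  proof (cases "t i \<le> t j")
    case True
    from energy_change_ordered[OF E True \<open>k \<ge> 2\<close>] show ?thesis
      using pos True unfolding G_def \<open>e = {u, v}\<close> by (auto split: if_splits simp: min_def)
  next
    case False
    then have le: "t j \<le> t i" by simp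
    have "{v, u} = {u, v}" by auto
    from energy_change_ordered[OF multipartite_edge_swap[OF E] le \<open>k \<ge> 2\<close>] show ?thesis
      using pos le unfolding G_def \<open>e = {u, v}\<close> \<open>{v, u} = {u, v}\<close>
      by (auto split: if_splits simp: min_def)
  qed
qed

end
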